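(* Let $G$ be an abelian Polish group that is not locally compact, and let $\xi$ be an ordinal with $1 \le \xi < \omega_1$. Then there exists a Borel Haar null set $B \subset G$ that is not contained in any $\mathbf{\Pi}^0_\xi$ Haar null subset of $G$; that is, there is no set $H \in \mathbf{\Pi}^0_\xi(G)$ that is Haar null and satisfies $B \subset H$.
   Context: An abelian Polish group is an abelian topological group (written additively) whose topology is separable and completely metrizable. A set $X \subset G$ is called Haar null if there exist a Borel set $B' \supset X$ and a Borel probability measure $\mu$ on $G$ such that $\mu(B'+g)=0$ for every $g \in G$. $\mathbf{\Pi}^0_\xi(G)$ denotes the $\xi$-th multiplicative class of the Borel hierarchy of subsets of $G$ (so $\mathbf{\Pi}^0_1$ is the class of closed sets and $\mathbf{\Pi}^0_2$ is the class of $G_\delta$ sets). *)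

theory Defs
  imports "HOL-Probability.Probability" "HOL-Library.Countable_Set_Type"
begin

text \<open>
  The countable ordinals. The field of \<^term>\<open>cardSuc natLeq\<close>, the successor cardinal of
  \<^term>\<open>natLeq\<close> seen as an initial ordinal, has order type \<open>\<omega>\<^sub>1\<close>, so its elements
  are the ordinals below \<open>\<omega>\<^sub>1\<close>.
\<close>

lemma Card_order_omega1: "Card_order (cardSuc natLeq)"
  by (simp add: cardSuc_Card_order natLeq_Card_order)

lemma Well_order_omega1: "Well_order (cardSuc natLeq)"
  using Card_order_omega1 unfolding card_order_on_def by blast

lemma infinite_Field_omega1: "infinite (Field (cardSuc natLeq))"
  using cardSuc_finite[OF natLeq_Card_order] by (simp add: Field_natLeq)

typedef omega1 = "Field (cardSuc natLeq)"
  using infinite_Field_omega1 infinite_imp_nonempty by blast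

instantiation omega1 :: linorder
begin

definition less_eq_omega1 :: "omega1 \<Rightarrow> omega1 \<Rightarrow> bool" where
  "\<xi> \<le> \<eta> \<longleftrightarrow> (Rep_omega1 \<xi>, Rep_omega1 \<eta>) \<in> cardSuc natLeq"

definition less_omega1 :: "omega1 \<Rightarrow> omega1 \<Rightarrow> bool" where
  "(\<xi> :: omega1) < \<eta> \<longleftrightarrow> \<xi> \<le> \<eta> \<and> \<xi> \<noteq> \<eta>"

instance
proof
  have W: "refl_on (Field (cardSuc natLeq)) (cardSuc natLeq)" "trans (cardSuc natLeq)"
    "antisym (cardSuc natLeq)" "total_on (Field (cardSuc natLeq)) (cardSuc natLeq)"
    using Well_order_omega1
    by (auto simp: well_order_on_def linear_order_on_def partial_order_on_def preorder_on_def)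
  fix x y z :: omega1
  show "x \<le> x"
    using W(1) Rep_omega1 by (auto simp: less_eq_omega1_def refl_on_def)
  show anti: "x = y" if "x \<le> y" "y \<le> x"
    using that W(3) unfolding less_eq_omega1_def by (metis Rep_omega1_inject antisymD)
  show "x < y \<longleftrightarrow> x \<le> y \<and> \<not> y \<le> x"
    using anti \<open>x \<le> x\<close> by (auto simp: less_omega1_def)
  show "x \<le> z" if "x \<le> y" "y \<le> z"
    using that W(2) unfolding less_eq_omega1_def by (blast dest: transD)
  show "x \<le> y \<or> y \<le> x"
    using W(4) Rep_omega1[of x] Rep_omega1[of y] \<open>x \<le> x\<close>
    unfolding less_eq_omega1_def total_on_def by (metis Rep_omega1_inject)
qed

end

instance omega1 :: wellorder
proof
  fix P :: "omega1 \<Rightarrow> bool" and a :: omega1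
  assume step: "\<And>x. (\<And>y. y < x \<Longrightarrow> P y) \<Longrightarrow> P x"
  have "wf (cardSuc natLeq - Id)"
    using Well_order_omega1 by (simp add: well_order_on_def)
  then have "wf (inv_image (cardSuc natLeq - Id) Rep_omega1)"
    by (rule wf_inv_image)
  moreover have "inv_image (cardSuc natLeq - Id) Rep_omega1 = {(x, y). x < y}"
    by (auto simp: less_omega1_def less_eq_omega1_def Rep_omega1_inject)
  ultimately show "P a"
    using step by (metis (no_types, lifting) case_prodI mem_Collect_eq wf_induct_rule)
qed

context includes cardinal_syntax
begin

lemma countable_lessThan_omega1: "countable {..<\<xi> :: omega1}"
proof -
  have "|underS (cardSuc natLeq) (Rep_omega1 \<xi>)| <o cardSuc natLeq"
    using Card_order_omega1 Rep_omega1 by (rule card_of_underS)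
  then have "countable (underS (cardSuc natLeq) (Rep_omega1 \<xi>))"
    by (simp add: countable_card_le_natLeq
        cardSuc_ordLeq_ordLess[OF natLeq_Card_order card_of_Card_order])
  moreover have "Rep_omega1 ` {..<\<xi>} \<subseteq> underS (cardSuc natLeq) (Rep_omega1 \<xi>)"
    by (auto simp: underS_def less_omega1_def less_eq_omega1_def Rep_omega1_inject)
  ultimately show ?thesis
    by (meson Rep_omega1_inject countable_image_inj_on countable_subset inj_onI)
qed

lemma uncountable_UNIV_omega1: "uncountable (UNIV :: omega1 set)"
proof
  assume "countable (UNIV :: omega1 set)"
  then have "countable (range Rep_omega1)"
    by (rule countable_image)
  moreover have "range Rep_omega1 = Field (cardSuc natLeq)"
    by (rule type_definition.Rep_range[OF type_definition_omega1])
  ultimately have "|Field (cardSuc natLeq)| \<le>o natLeq"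
    by (simp add: countable_card_le_natLeq)
  then have "cardSuc natLeq \<le>o natLeq"
    using card_of_Field_ordIso[OF Card_order_omega1] ordIso_ordLeq_trans ordIso_symmetric by blast
  then show False
    using cardSuc_greater[OF natLeq_Card_order] not_ordLess_ordLeq by blast
qed

end

instantiation omega1 :: "{zero, one}"
begin

definition zero_omega1 :: omega1 where "0 = (LEAST \<xi> :: omega1. True)"
definition one_omega1 :: omega1 where "1 = (LEAST \<xi>. (0 :: omega1) < \<xi>)"

instance ..

end

lemma omega1_zero_le: "(0 :: omega1) \<le> \<xi>"
  by (simp add: zero_omega1_def Least_le)

lemma omega1_one_le_iff: "(1 :: omega1) \<le> \<xi> \<longleftrightarrow> 0 < \<xi>"
proof -
  have "\<exists>\<eta> :: omega1. 0 < \<eta>"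
  proof (rule ccontr)
    assume "\<nexists>\<eta> :: omega1. 0 < \<eta>"
    then have "(UNIV :: omega1 set) = {0}"
      using omega1_zero_le by (auto simp: not_less order_antisym)
    then show False
      using uncountable_UNIV_omega1 by (metis countable_empty countable_insert)
  qed
  then have "(0 :: omega1) < 1"
    unfolding one_omega1_def by (rule LeastI_ex)
  then show ?thesis
    unfolding one_omega1_def using Least_le order_less_le_trans by metis
qed

text \<open>
  The Borel hierarchy, indexed by \<open>1 \<le> \<xi> < \<omega>\<^sub>1\<close>; both classes are empty for \<open>\<xi> = 0\<close>.
  The premise on \<open>- A n\<close> says that \<open>A n\<close> belongs to the multiplicative class of index \<open>\<eta> n\<close>.
\<close>

inductive in_Sigma0 :: "omega1 \<Rightarrow> 'a::topological_space set \<Rightarrow> bool" where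
  in_Sigma0_open: "open U \<Longrightarrow> in_Sigma0 1 U"
| in_Sigma0_Union: "1 < \<xi> \<Longrightarrow> (\<And>n :: nat. 1 \<le> \<eta> n \<and> \<eta> n < \<xi> \<and> in_Sigma0 (\<eta> n) (- A n))
    \<Longrightarrow> in_Sigma0 \<xi> (\<Union>n. A n)"

definition Sigma0 :: "omega1 \<Rightarrow> 'a::topological_space set set" where
  "Sigma0 \<xi> = {A. in_Sigma0 \<xi> A}"

definition Pi0 :: "omega1 \<Rightarrow> 'a::topological_space set set" where
  "Pi0 \<xi> = {A. - A \<in> Sigma0 \<xi>}"

lemma Pi0_one: "Pi0 1 = {A :: 'a::topological_space set. closed A}"
proof -
  have "in_Sigma0 1 U \<longleftrightarrow> open U" for U :: "'a set"
    by (subst in_Sigma0.simps) simp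
  then show ?thesis
    by (simp add: Pi0_def Sigma0_def closed_def)
qed

lemma Sigma0_eq_Union:
  assumes "1 < \<xi>"
  shows "Sigma0 \<xi> = {(\<Union>n :: nat. A n) | A :: nat \<Rightarrow> 'a::topological_space set. \<forall>n. \<exists>\<eta>. 1 \<le> \<eta> \<and> \<eta> < \<xi> \<and> A n \<in> Pi0 \<eta>}"
    (is "_ = ?R")
proof
  show "Sigma0 \<xi> \<subseteq> ?R"
  proof
    fix X :: "'a set" assume "X \<in> Sigma0 \<xi>"
    then have "in_Sigma0 \<xi> X"
      by (simp add: Sigma0_def)
    then show "X \<in> ?R"
    proof cases
      case in_Sigma0_open
      then show ?thesis using assms by simp
    next
      case (in_Sigma0_Union \<eta> A)
      then show ?thesis by (auto simp: Pi0_def Sigma0_def)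
    qed
  qed
  show "?R \<subseteq> Sigma0 \<xi>"
  proof
    fix X :: "'a set" assume "X \<in> ?R"
    then obtain A where X: "X = (\<Union>n :: nat. A n)"
      and "\<forall>n. \<exists>\<eta>. 1 \<le> \<eta> \<and> \<eta> < \<xi> \<and> A n \<in> Pi0 \<eta>" by blast
    then obtain \<eta> where "\<And>n. 1 \<le> \<eta> n \<and> \<eta> n < \<xi> \<and> A n \<in> Pi0 (\<eta> n)" by metis
    then show "X \<in> Sigma0 \<xi>"
      unfolding X using in_Sigma0_Union[OF assms, of \<eta> A] by (simp add: Pi0_def Sigma0_def)
  qed
qed

definition haar_null :: "'a::{topological_space, ab_group_add} set \<Rightarrow> bool" where
  "haar_null X \<longleftrightarrow> (\<exists>B \<in> sets borel. X \<subseteq> B \<and>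
     (\<exists>\<mu>. prob_space \<mu> \<and> sets \<mu> = sets borel \<and> (\<forall>g. emeasure \<mu> ((\<lambda>x. x + g) ` B) = 0)))"

end

theory Submission
  imports Defs
begin

text \<open>
  The construction follows Elekes and Vidnyanszky. Since \<open>G\<close> is not locally compact, there is a
  continuous \<open>t\<close> from the Baire space to \<open>G\<close> such that \<open>y\<close> can be decoded from every point of
  \<open>K + t y\<close>, for \<open>K\<close> compact and \<open>y\<close> growing fast enough, even after a shift by a fixed compact set
  \<open>C\<close> that carries an atomless measure \<open>\<nu>\<close>. Let \<open>y\<close> code a triple \<open>(q, x, r)\<close>, where \<open>q\<close> codes a
  probability measure \<open>\<mu>\<close> on \<open>G\<close>, \<open>x\<close> a \<open>\<Pi>\<^sup>0\<^sub>\<xi>\<close> subset of \<open>\<omega>\<^sup>\<omega> \<times> G\<close> with section \<open>S\<close> at \<open>x\<close>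
  itself, and \<open>r\<close> bounds a compact set \<open>K\<close>. If \<open>\<mu> (K - S) > 0\<close>, a Borel uniformization picks a point
  \<open>p y\<close> of \<open>K - S\<close>. The set \<open>E\<close> of all \<open>p y + t y\<close> is Borel by decoding, and every translate of
  \<open>E\<close> meets \<open>C\<close> in at most one point, so \<open>\<nu>\<close> witnesses that \<open>E\<close> is Haar null. If \<open>H \<supseteq> E\<close> is
  \<open>\<Pi>\<^sup>0\<^sub>\<xi>\<close> and Haar null with witness \<open>\<mu>\<close>, let \<open>x\<close> code \<open>{(x', g). g + t (q, x', r) \<in> H}\<close>: its section
  at \<open>x\<close> is a translate of \<open>H\<close>, hence \<open>\<mu>\<close>-null, and \<open>p y + t y\<close> is a point of \<open>E\<close> outside \<open>H\<close>.
\<close>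

section \<open>Universal sets for the Borel hierarchy\<close>

lemma in_Sigma0_borel: "in_Sigma0 \<xi> A \<Longrightarrow> A \<in> sets borel"
proof (induction rule: in_Sigma0.induct)
  case (in_Sigma0_Union \<xi> \<eta> A)
  then have "- A n \<in> sets borel" for n
    by blast
  then have "A n \<in> sets borel" for n
    using borel_comp[of "- A n"] by simp
  then show ?case
    by blast
qed simp

lemma Pi0_borel: "A \<in> Pi0 \<xi> \<Longrightarrow> A \<in> sets borel"
  using in_Sigma0_borel borel_comp by (fastforce simp: Pi0_def Sigma0_def)

lemma in_Sigma0_vimage:
  "in_Sigma0 \<xi> A \<Longrightarrow> continuous_on UNIV f \<Longrightarrow> in_Sigma0 \<xi> (f -` A)"
proof (induction rule: in_Sigma0.induct)
  case (in_Sigma0_open U)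
  then show ?case
    by (auto intro!: in_Sigma0.in_Sigma0_open open_vimage)
next
  case (in_Sigma0_Union \<xi> \<eta> A)
  then show ?case
    using in_Sigma0.in_Sigma0_Union[of \<xi> \<eta> "\<lambda>n. f -` A n"] by (simp add: vimage_UN vimage_Compl)
qed

lemma Pi0_vimage: "A \<in> Pi0 \<xi> \<Longrightarrow> continuous_on UNIV f \<Longrightarrow> f -` A \<in> Pi0 \<xi>"
  by (simp add: Pi0_def Sigma0_def in_Sigma0_vimage flip: vimage_Compl)

lemma open_coordinate_eq: "open {c :: 'a \<Rightarrow> 'b::discrete_topology. c i = k}"
  using open_vimage[OF discrete_topology_class.open_discrete continuous_on_product_coordinates,
      of i "{k}"] by (simp add: vimage_def)

text \<open>Induction on \<xi>. For \<xi> = 1 a code lists basic open sets. For \<xi> > 1 it lists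
  codes for lower classes together with the names of these classes; there are only countably many of
  them, so the lower universal sets can be glued into one Borel set.\<close>

lemma borel_universal_Sigma0:
  "\<exists>U :: ((nat \<Rightarrow> nat) \<times> 'a::second_countable_topology) set.
     U \<in> sets borel \<and> (\<forall>S. in_Sigma0 \<xi> S \<longrightarrow> (\<exists>c. S = {p. (c, p) \<in> U}))"
proof (induction \<xi> rule: less_induct)
  case (less \<xi>)
  consider "\<xi> < 1" | "\<xi> = 1" | "1 < \<xi>"
    by (metis linorder_neqE)
  then show ?case
  proof cases
    case 1
    then have "\<not> in_Sigma0 \<xi> S" for S :: "'a set"
      by (subst in_Sigma0.simps) auto
    then show ?thesis
      by blast
  next
    case 2
    obtain \<B> :: "'a set set" where \<B>: "countable \<B>" "topological_basis \<B>"
      using ex_countable_basis by blast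
    \<comment> \<open>Index 0 is reserved for the empty set, which occurs in the lists below
      although it need not belong to the basis.\<close>
    define b where "b n = (case n of 0 \<Rightarrow> {} | Suc m \<Rightarrow> from_nat_into (insert {} \<B>) m)" for n :: nat
    have b_open: "open (b n)" for n
    proof (cases n)
      case (Suc m)
      have "from_nat_into (insert {} \<B>) m \<in> insert {} \<B>"
        by (rule from_nat_into) simp
      then show ?thesis
        using \<B>(2) topological_basis_open unfolding Suc b_def by (metis insert_iff nat.case(2) open_empty)
    qed (simp add: b_def)
    have b_ex: "\<exists>n. b n = B" if B: "B \<in> \<B>" for B
    proof -
      obtain m where "from_nat_into (insert {} \<B>) m = B"
        using from_nat_into_surj[of "insert {} \<B>" B] B \<B>(1) by auto
      then show ?thesis
        by (intro exI[of _ "Suc m"]) (simp add: b_def)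
    qed
    define U where "U = (\<Union>n k. {c :: nat \<Rightarrow> nat. c n = k} \<times> b k)"
    have "U \<in> sets borel"
      unfolding U_def by (intro borel_open open_UN ballI open_Times b_open open_coordinate_eq)
    moreover have "\<exists>c. S = {p. (c, p) \<in> U}" if "in_Sigma0 \<xi> S" for S
    proof -
      have "open S"
        using that 2 by (subst (asm) in_Sigma0.simps) auto
      then obtain \<B>' where \<B>': "\<B>' \<subseteq> \<B>" "S = \<Union>\<B>'"
        using \<B>(2) unfolding topological_basis_def by blast
      have ne: "countable (insert {} \<B>')" "insert {} \<B>' \<noteq> {}"
        using \<B>(1) \<B>'(1) countable_subset by auto
      have "\<exists>k. b k = from_nat_into (insert {} \<B>') n" for n
      proof (cases "from_nat_into (insert {} \<B>') n = {}")
        case True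
        then show ?thesis
          by (intro exI[of _ 0]) (simp add: b_def)
      next
        case False
        then show ?thesis
          using from_nat_into[OF ne(2), of n] \<B>'(1) b_ex by auto
      qed
      then obtain c where c: "\<And>n. b (c n) = from_nat_into (insert {} \<B>') n"
        by metis
      have "(\<Union>n. b (c n)) = \<Union> (insert {} \<B>')"
        unfolding c using range_from_nat_into[OF ne(2,1)] by metis
      then show ?thesis
        unfolding \<B>'(2) U_def by (intro exI[of _ c]) auto
    qed
    ultimately show ?thesis
      by blast
  next
    case 3
    define e where "e = from_nat_into {\<eta>. 1 \<le> \<eta> \<and> \<eta> < \<xi>}"
    have ne: "{\<eta>. 1 \<le> \<eta> \<and> \<eta> < \<xi>} \<noteq> {}"
      using 3 by auto
    have cnt: "countable {\<eta>. 1 \<le> \<eta> \<and> \<eta> < \<xi>}"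
      by (rule countable_subset[OF _ countable_lessThan_omega1[of \<xi>]]) auto
    have e: "e k < \<xi>" for k
      using from_nat_into[OF ne] unfolding e_def by blast
    have "\<forall>k. \<exists>V :: ((nat \<Rightarrow> nat) \<times> 'a) set. V \<in> sets borel \<and>
        (\<forall>S. in_Sigma0 (e k) S \<longrightarrow> (\<exists>c. S = {p. (c, p) \<in> V}))"
      using less[OF e] by blast
    then obtain V :: "nat \<Rightarrow> ((nat \<Rightarrow> nat) \<times> 'a) set" where V: "\<And>k. V k \<in> sets borel"
      "\<And>k S. in_Sigma0 (e k) S \<Longrightarrow> \<exists>c. S = {p. (c, p) \<in> V k}"
      by metis
    \<comment> \<open>One sequence stores countably many codes: entry \<open>(0, n)\<close> names a
      lower class, and the entries \<open>(Suc i, n)\<close> form the code \<open>d n c\<close> for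
      it.\<close>
    define d where "d n c = (\<lambda>i. c (prod_encode (Suc i, n)))" for n and c :: "nat \<Rightarrow> nat"
    define U where "U = (\<Union>n k. {(c, p). c (prod_encode (0, n)) = k \<and> (d n c, p) \<notin> V k})"
    have "{(c, p). c (prod_encode (0, n)) = k \<and> (d n c, p) \<notin> V k} \<in> sets borel" for n k
    proof -
      have "continuous_on UNIV (\<lambda>(c, p :: 'a). (d n c, p))"
        unfolding d_def case_prod_unfold
        by (intro continuous_intros continuous_on_product_then_coordinatewise)
      then have "(\<lambda>(c, p :: 'a). (d n c, p)) -` (- V k) \<in> sets borel"
        by (intro measurable_sets_borel[OF borel_measurable_continuous_onI] borel_comp V(1))
      moreover have "{c :: nat \<Rightarrow> nat. c (prod_encode (0, n)) = k} \<times> (UNIV :: 'a set) \<in> sets borel"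
        by (intro borel_open open_Times open_coordinate_eq open_UNIV)
      ultimately have "({c. c (prod_encode (0, n)) = k} \<times> UNIV) \<inter>
          (\<lambda>(c, p). (d n c, p)) -` (- V k) \<in> sets borel"
        by (rule sets.Int[rotated])
      then show ?thesis
        by (rule back_subst[of "\<lambda>X. X \<in> sets borel"]) auto
    qed
    then have "U \<in> sets borel"
      unfolding U_def by blast
    moreover have "\<exists>c. S = {p. (c, p) \<in> U}" if "in_Sigma0 \<xi> S" for S
      using that
    proof cases
      case in_Sigma0_open
      then show ?thesis
        using 3 by simp
    next
      case (in_Sigma0_Union \<eta> A)
      have "\<exists>k c. e k = \<eta> n \<and> - A n = {p. (c, p) \<in> V k}" for n
      proof -
        obtain k where "e k = \<eta> n"
          using from_nat_into_surj[OF cnt, of "\<eta> n"] in_Sigma0_Union unfolding e_def by auto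
        then show ?thesis
          using V(2)[of k] in_Sigma0_Union by metis
      qed
      then obtain k c where kc: "\<And>n. - A n = {p. (c n, p) \<in> V (k n)}"
        by metis
      define c' where "c' i = (case prod_decode i of (0, n) \<Rightarrow> k n | (Suc j, n) \<Rightarrow> c n j)" for i
      have "c' (prod_encode (0, n)) = k n" "d n c' = c n" for n
        by (auto simp: c'_def d_def)
      then have "{p. (c', p) \<in> U} = (\<Union>n. - {p. (c n, p) \<in> V (k n)})"
        by (auto simp: U_def)
      also have "\<dots> = S"
        using in_Sigma0_Union unfolding kc[symmetric] by simp
      finally show ?thesis
        by blast
    qed
    ultimately show ?thesis
      by blast
  qed
qed

section \<open>Completeness of Polish groups\<close>

lemma open_contains_ball_half_power:
  fixes U :: "'a::metric_space set"
  assumes "open U" "x \<in> U"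
  obtains n where "ball x ((1 / 2) ^ n) \<subseteq> U"
proof -
  obtain \<epsilon> where \<epsilon>: "\<epsilon> > 0" "ball x \<epsilon> \<subseteq> U"
    using assms open_contains_ball by blast
  obtain n where "(1 / 2) ^ n < \<epsilon>"
    using real_arch_pow_inv[OF \<epsilon>(1), of "1 / 2"] by auto
  then have "ball x ((1 / 2) ^ n) \<subseteq> ball x \<epsilon>"
    by (intro subset_ball) simp
  then show ?thesis
    using that \<epsilon>(2) by blast
qed

lemma dense_sequence:
  obtains d :: "nat \<Rightarrow> 'a::second_countable_topology"
  where "\<And>U. open U \<Longrightarrow> U \<noteq> {} \<Longrightarrow> \<exists>i. d i \<in> U"
proof -
  obtain S :: "'a set" where S: "countable S" "\<And>X. open X \<Longrightarrow> X \<noteq> {} \<Longrightarrow> \<exists>s\<in>S. s \<in> X"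
    using countable_dense_setE by (metis (full_types))
  have "\<exists>i. from_nat_into S i \<in> U" if "open U" "U \<noteq> {}" for U
    using S(2)[OF that] from_nat_into_surj[OF S(1)] by metis
  then show ?thesis
    by (rule that)
qed

lemma zero_nhd_halve:
  fixes U :: "'a::topological_ab_group_add set"
  assumes "open U" "0 \<in> U"
  obtains V where "open V" "0 \<in> V" "\<And>x. x \<in> V \<Longrightarrow> - x \<in> V"
    "\<And>x y. x \<in> V \<Longrightarrow> y \<in> V \<Longrightarrow> x + y \<in> U"
proof -
  have "open ((\<lambda>p :: 'a \<times> 'a. fst p + snd p) -` U)"
    by (intro open_vimage assms continuous_intros)
  then obtain A B where AB: "open A" "open B" "(0, 0) \<in> A \<times> B"
    "A \<times> B \<subseteq> (\<lambda>p :: 'a \<times> 'a. fst p + snd p) -` U"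
    by (rule open_prod_elim[of _ "(0, 0)"]) (use assms(2) in auto)
  define V where "V = (A \<inter> B) \<inter> uminus -` (A \<inter> B)"
  have "open V"
    unfolding V_def using AB by (intro open_Int open_vimage continuous_intros)
  moreover have "0 \<in> V" "\<And>x. x \<in> V \<Longrightarrow> - x \<in> V"
    using AB by (auto simp: V_def)
  moreover have "x + y \<in> U" if "x \<in> V" "y \<in> V" for x y
    using that AB(4) by (auto simp: V_def subset_iff)
  ultimately show ?thesis
    using that by blast
qed

lemma open_translate_vimage:
  fixes U :: "'a::topological_ab_group_add set"
  assumes "open U"
  shows "open {u. a + u \<in> U}" "open {u. u - a \<in> U}"
proof -
  have "continuous_on UNIV (\<lambda>u. a + u)" "continuous_on UNIV (\<lambda>u. u - a)"
    by (intro continuous_intros)+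
  then show "open {u. a + u \<in> U}" "open {u. u - a \<in> U}"
    using open_vimage[OF assms] by (auto simp: vimage_def)
qed

text \<open>Klee's theorem: the sets \<open>A k\<close> of all \<open>g\<close> for which the translated sequence \<open>g + x n\<close>
  eventually oscillates by less than \<open>2\<^sup>-\<^sup>k\<close>, uniformly near \<open>g\<close>, are open and dense.\<close>

lemma group_Cauchy_convergent:
  fixes x :: "nat \<Rightarrow> 'a::{topological_ab_group_add, complete_space}"
  assumes C: "\<And>U. open U \<Longrightarrow> 0 \<in> U \<Longrightarrow> \<exists>N. \<forall>m\<ge>N. \<forall>n\<ge>N. x m - x n \<in> U"
  shows "convergent x"
proof -
  define osc where "osc g k N n0 \<longleftrightarrow> (\<forall>n m u v. n0 \<le> n \<longrightarrow> n0 \<le> m \<longrightarrow> u \<in> N \<longrightarrow> v \<in> N \<longrightarrow>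
    dist (g + x n + u) (g + x m + v) < (1 / 2) ^ k)" for g N and k n0 :: nat
  define A where "A k = {g. \<exists>N n0. open N \<and> 0 \<in> N \<and> osc g k N n0}" for k
  have A_open: "open (A k)" for k
  proof (subst open_subopen, intro ballI)
    fix g assume "g \<in> A k"
    then obtain N n0 where N: "open N" "0 \<in> N" "osc g k N n0"
      unfolding A_def by blast
    from zero_nhd_halve[OF N(1,2)] obtain V where
      V: "open V" "0 \<in> V" "\<And>x y. x \<in> V \<Longrightarrow> y \<in> V \<Longrightarrow> x + y \<in> N"
      by metis
    have "g' \<in> A k" if "g' - g \<in> V" for g'
    proof -
      have "osc g' k V n0"
        unfolding osc_def
      proof (intro allI impI)
        fix n m u v assume "n0 \<le> n" "n0 \<le> m" "u \<in> V" "v \<in> V"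
        then have "dist (g + x n + (g' - g + u)) (g + x m + (g' - g + v)) < (1 / 2) ^ k"
          using N(3) V(3)[OF that] unfolding osc_def by blast
        then show "dist (g' + x n + u) (g' + x m + v) < (1 / 2) ^ k"
          by (simp add: algebra_simps)
      qed
      then show ?thesis
        unfolding A_def using V(1,2) by blast
    qed
    then show "\<exists>T. open T \<and> g \<in> T \<and> T \<subseteq> A k"
      using open_translate_vimage(2)[OF V(1), of g] V(2) by (intro exI[of _ "{u. u - g \<in> V}"]) auto
  qed
  have A_dense: "closure (A k) = UNIV" for k
  proof -
    have "\<exists>g\<in>A k. g \<in> S" if S: "open S" "g0 \<in> S" for S g0
    proof -
      obtain n1 where n1: "\<And>m n. m \<ge> n1 \<Longrightarrow> n \<ge> n1 \<Longrightarrow> g0 + (x m - x n) \<in> S"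
        using C[OF open_translate_vimage(1)[OF S(1), of g0]] S(2) by auto
      define h where "h = g0 + x n1"
      have "open {u. h + u \<in> ball h ((1 / 2) ^ Suc k)}" "0 \<in> {u. h + u \<in> ball h ((1 / 2) ^ Suc k)}"
        by (simp_all add: open_translate_vimage del: mem_ball power_Suc)
      from zero_nhd_halve[OF this] obtain V where
        V: "open V" "0 \<in> V" "\<And>x y. x \<in> V \<Longrightarrow> y \<in> V \<Longrightarrow> h + (x + y) \<in> ball h ((1 / 2) ^ Suc k)"
        by (metis mem_Collect_eq)
      obtain n2 where n2: "\<And>m n. m \<ge> n2 \<Longrightarrow> n \<ge> n2 \<Longrightarrow> x m - x n \<in> V"
        using C[OF V(1,2)] by blast
      define n3 where "n3 = max n1 n2"
      \<comment> \<open>With this choice \<open>g + x n = h + (x n - x n3)\<close> stays near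
        \<open>h\<close> for large \<open>n\<close>, while \<open>g\<close> differs from
        \<open>g0\<close> only by \<open>x n1 - x n3\<close> and so remains in
        \<open>S\<close>.\<close>
      define g where "g = h - x n3"
      have "g = g0 + (x n1 - x n3)"
        by (simp add: g_def h_def algebra_simps)
      then have "g \<in> S"
        using n1[of n1 n3] by (simp add: n3_def)
      moreover have "g \<in> A k"
      proof -
        have "dist h (g + x n + u) < (1 / 2) ^ Suc k" if "n \<ge> n3" "u \<in> V" for n u
          using V(3)[OF n2[of n n3] that(2)] that(1) by (simp add: n3_def g_def algebra_simps del: power_Suc)
        then have "dist (g + x n + u) (g + x m + v) < (1 / 2) ^ Suc k + (1 / 2) ^ Suc k"
          if "n \<ge> n3" "m \<ge> n3" "u \<in> V" "v \<in> V" for n m u v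
          using that by (meson add_strict_mono dist_triangle3 order_le_less_trans)
        then have "osc g k V n3"
          unfolding osc_def by simp
        then show ?thesis
          unfolding A_def using V(1,2) by blast
      qed
      ultimately show ?thesis
        by blast
    qed
    then show ?thesis
      by (auto simp: closure_iff_nhds_not_empty) (metis disjoint_iff subsetD)
  qed
  \<comment> \<open>The complete metric need not be translation invariant, so \<open>x\<close>
    itself may fail to be metrically Cauchy. Its translate by a point common to all
    \<open>A k\<close> is Cauchy.\<close>
  have "(euclidean :: 'a topology) closure_of (\<Inter>(range A)) = topspace euclidean"
    by (rule Baire_category)
       (auto simp: completely_metrizable_space_euclidean A_open A_dense)
  then obtain g where "g \<in> \<Inter>(range A)"
    by (metis closure_of_empty equals0I topspace_euclidean UNIV_not_empty)
  have g: "\<exists>n0. \<forall>n\<ge>n0. \<forall>m\<ge>n0. dist (g + x n) (g + x m) < (1 / 2) ^ k" for k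
  proof -
    obtain N n0 where "0 \<in> N" "osc g k N n0"
      using \<open>g \<in> \<Inter>(range A)\<close> unfolding A_def by blast
    then have "dist (g + x n + 0) (g + x m + 0) < (1 / 2) ^ k" if "n \<ge> n0" "m \<ge> n0" for n m
      using that unfolding osc_def by blast
    then show ?thesis
      by auto
  qed
  have "Cauchy (\<lambda>n. g + x n)"
  proof (rule metric_CauchyI)
    fix e :: real assume "e > 0"
    then obtain k where "(1 / 2) ^ k < e"
      using real_arch_pow_inv[of e "1 / 2"] by auto
    then show "\<exists>M. \<forall>m\<ge>M. \<forall>n\<ge>M. dist (g + x m) (g + x n) < e"
      using g[of k] less_trans by blast
  qed
  then obtain l where "(\<lambda>n. g + x n) \<longlonglongrightarrow> l"
    using Cauchy_convergent convergent_def by blast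
  then have "(\<lambda>n. (g + x n) - g) \<longlonglongrightarrow> l - g"
    by (intro tendsto_intros)
  then show ?thesis
    by (auto simp: convergent_def)
qed

text \<open>If every \<open>V\<close> had a compact \<open>L\<close> with \<open>U\<close> inside
  \<open>L + V\<close>, each sequence in a closed ball inside \<open>U\<close> would have a diagonal
  subsequence that is Cauchy for the group structure, hence convergent. The ball would be compact,
  and its translates would give local compactness.\<close>

lemma not_locally_compact_nhd_not_covered:
  fixes U :: "'a::{topological_ab_group_add, complete_space} set"
  assumes nlc: "\<not> locally_compact_space (euclidean :: 'a topology)" and U: "open U" "0 \<in> U"
  shows "\<exists>V. open V \<and> 0 \<in> V \<and> (\<forall>L. compact L \<longrightarrow> (\<exists>u\<in>U. \<forall>l\<in>L. u - l \<notin> V))"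
proof (rule ccontr)
  assume neg: "\<not> ?thesis"
  have cover: "\<exists>L. compact L \<and> (\<forall>u\<in>U. \<exists>l\<in>L. u - l \<in> V)" if "open V" "0 \<in> V" for V
    using neg[unfolded not_ex, rule_format, of V] that by auto
  obtain e where e: "e > 0" "cball 0 e \<subseteq> U"
    using U open_contains_cball by blast
  have "seq_compact (cball (0 :: 'a) e)"
    unfolding seq_compact_def
  proof (intro allI impI)
    fix f :: "nat \<Rightarrow> 'a" assume f: "\<forall>n. f n \<in> cball 0 e"
    define P where "P n s \<longleftrightarrow> (\<forall>i j. f (s i) - f (s j) \<in> ball 0 ((1 / 2) ^ n))" for n and s :: "nat \<Rightarrow> nat"
    interpret subseqs P
    proof
      fix n and s :: "nat \<Rightarrow> nat" assume s: "strict_mono s"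
      from zero_nhd_halve[of "ball (0 :: 'a) ((1 / 2) ^ n)"] obtain V where V: "open V" "0 \<in> V" "\<And>x. x \<in> V \<Longrightarrow> - x \<in> V"
        "\<And>x y. x \<in> V \<Longrightarrow> y \<in> V \<Longrightarrow> x + y \<in> ball (0 :: 'a) ((1 / 2) ^ n)"
        by auto
      from zero_nhd_halve[OF V(1,2)] obtain W where W: "open W" "0 \<in> W" "\<And>x. x \<in> W \<Longrightarrow> - x \<in> W"
        "\<And>x y. x \<in> W \<Longrightarrow> y \<in> W \<Longrightarrow> x + y \<in> V"
        by metis
      obtain L where L: "compact L" "\<And>u. u \<in> U \<Longrightarrow> \<exists>l\<in>L. u - l \<in> W"
        using cover[OF W(1,2)] by blast
      have "\<forall>i. \<exists>l\<in>L. f (s i) - l \<in> W"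
        using L(2) f e(2) by blast
      then obtain l where l: "\<And>i. l i \<in> L" "\<And>i. f (s i) - l i \<in> W"
        by metis
      obtain l0 r where r: "strict_mono r" "(l \<circ> r) \<longlonglongrightarrow> l0"
        using L(1) l(1) unfolding compact_eq_seq_compact_metric seq_compact_def by metis
      have "\<forall>\<^sub>F i in sequentially. (l \<circ> r) i \<in> {u. u - l0 \<in> W}"
        by (rule topological_tendstoD[OF r(2)]) (use W open_translate_vimage in auto)
      then obtain i0 where i0: "\<And>i. i \<ge> i0 \<Longrightarrow> l (r i) - l0 \<in> W"
        by (auto simp: eventually_sequentially)
      \<comment> \<open>Dropping the first \<open>i0\<close> terms makes the estimate in
        \<open>P n\<close> hold for all pairs of indices rather than eventually.\<close>
      define r' where "r' i = r (i + i0)" for i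
      have "strict_mono r'"
        using r(1) by (auto simp: r'_def strict_mono_def)
      moreover have "P n (s \<circ> r')"
      proof -
        have V': "f (s (r' i)) - l0 \<in> V" for i
          using W(4)[OF l(2)[of "r' i"] i0[of "i + i0"]] by (simp add: r'_def)
        have "f (s (r' i)) - f (s (r' j)) \<in> ball 0 ((1 / 2) ^ n)" for i j
          using V(4)[OF V'[of i] V(3)[OF V'[of j]]] by simp
        then show ?thesis
          by (simp add: P_def)
      qed
      ultimately show "\<exists>r'. strict_mono r' \<and> P n (s \<circ> r')"
        by blast
    qed
    have d: "P k (diagseq \<circ> (+) (Suc k))" for k
      by (rule diagseq_holds) (simp add: P_def)
    have "convergent (f \<circ> diagseq)"
    proof (rule group_Cauchy_convergent)
      fix U :: "'a set" assume "open U" "0 \<in> U"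
      then obtain k where k: "ball 0 ((1 / 2) ^ k) \<subseteq> U"
        by (rule open_contains_ball_half_power)
      have "(f \<circ> diagseq) m - (f \<circ> diagseq) n \<in> U" if "m \<ge> Suc k" "n \<ge> Suc k" for m n
      proof -
        have "f (diagseq (Suc k + (m - Suc k))) - f (diagseq (Suc k + (n - Suc k))) \<in> ball 0 ((1 / 2) ^ k)"
          using d[of k] unfolding P_def o_def by blast
        then show ?thesis
          using k that by (simp add: subset_iff)
      qed
      then show "\<exists>N. \<forall>m\<ge>N. \<forall>n\<ge>N. (f \<circ> diagseq) m - (f \<circ> diagseq) n \<in> U"
        by blast
    qed
    then obtain l where l: "(f \<circ> diagseq) \<longlonglongrightarrow> l"
      by (auto simp: convergent_def)
    have "l \<in> cball 0 e"
      by (rule closed_sequentially[OF closed_cball _ l]) (use f in simp)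
    then show "\<exists>l\<in>cball 0 e. \<exists>r. strict_mono r \<and> (f \<circ> r) \<longlonglongrightarrow> l"
      using l subseq_diagseq by blast
  qed
  then have cpt: "compact (cball (0 :: 'a) e)"
    by (simp add: compact_eq_seq_compact_metric)
  have "locally_compact_space (euclidean :: 'a topology)"
    unfolding locally_compact_space_def
  proof
    fix x :: 'a
    have "compact ((+) x ` cball 0 e)"
      by (intro compact_continuous_image cpt continuous_intros)
    moreover have "open {u. u - x \<in> ball 0 e}"
      by (intro open_translate_vimage) simp
    moreover have "{u. u - x \<in> ball 0 e} \<subseteq> (+) x ` cball 0 e"
      by (force simp: image_iff intro: bexI[of _ "_ - x"])
    ultimately show "\<exists>U K. openin euclidean U \<and> compactin euclidean K \<and> x \<in> U \<and> U \<subseteq> K"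
      using e(1) by (intro exI[of _ "{u. u - x \<in> ball 0 e}"] exI[of _ "(+) x ` cball 0 e"]) auto
  qed
  then show False
    using nlc by blast
qed

section \<open>Decodable translations\<close>

text \<open>These neighbourhoods control an infinite sum with one summand from each
  \<open>T n\<close>. Finite stretches of summands after stage \<open>n\<close> add up to points of
  \<open>X n\<close>, the inclusion of \<open>X n + X n\<close> in \<open>V n\<close> absorbs the
  passage to the limit, and combinations of four errors from \<open>V n\<close> fit in
  \<open>D n\<close>, which is so small that no compact set enlarged by \<open>D n\<close> covers
  \<open>T n\<close>.\<close>

lemma separating_nhd_sequence:
  assumes nlc: "\<not> locally_compact_space (euclidean :: 'a::{topological_ab_group_add, complete_space} topology)"
  obtains T V X D :: "nat \<Rightarrow> 'a::{topological_ab_group_add, complete_space} set" where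
    "\<And>n. open (T n)" "\<And>n. open (V n)" "\<And>n. open (X n)"
    "\<And>n. 0 \<in> T n" "\<And>n. 0 \<in> V n" "\<And>n. 0 \<in> X n"
    "\<And>n L. compact L \<Longrightarrow> \<exists>u\<in>T n. \<forall>l\<in>L. u - l \<notin> D n"
    "\<And>n a b c d. a \<in> V n \<Longrightarrow> b \<in> V n \<Longrightarrow> c \<in> V n \<Longrightarrow> d \<in> V n \<Longrightarrow> a + b - (c + d) \<in> D n"
    "\<And>n a b. a \<in> V n \<Longrightarrow> b \<in> V n \<Longrightarrow> a - b \<in> ball 0 ((1 / 2) ^ n)"
    "\<And>n a b. a \<in> X n \<Longrightarrow> b \<in> X n \<Longrightarrow> a + b \<in> V n"
    "\<And>n a b. a \<in> T (Suc n) \<Longrightarrow> b \<in> T (Suc n) \<Longrightarrow> a + b \<in> X n \<inter> T n"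
proof -
  define uncovered where "uncovered T D \<longleftrightarrow> (\<forall>L. compact L \<longrightarrow> (\<exists>u\<in>T. \<forall>l\<in>L. u - l \<notin> D))" for T D :: "'a set"
  define P where "P T \<longleftrightarrow> open T \<and> 0 \<in> T" for T :: "'a set"
  define Q where "Q n T T' D V X \<longleftrightarrow> P V \<and> P X \<and> uncovered T D \<and>
    (\<forall>a\<in>V. \<forall>b\<in>V. \<forall>c\<in>V. \<forall>d\<in>V. a + b - (c + d) \<in> D) \<and>
    (\<forall>a\<in>V. \<forall>b\<in>V. a - b \<in> ball 0 ((1 / 2) ^ n)) \<and>
    (\<forall>a\<in>X. \<forall>b\<in>X. a + b \<in> V) \<and> (\<forall>a\<in>T'. \<forall>b\<in>T'. a + b \<in> X \<inter> T)"
    for n :: nat and T T' D V X :: "'a set"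
  have step: "\<exists>T'. P T' \<and> (\<exists>D V X. Q n T T' D V X)" if TP: "P T" for T n
  proof -
    obtain D where D: "open D" "0 \<in> D" "uncovered T D"
      using not_locally_compact_nhd_not_covered[OF nlc, of T] TP unfolding P_def uncovered_def by blast
    have "open (D \<inter> ball 0 ((1 / 2) ^ n))" "0 \<in> D \<inter> ball 0 ((1 / 2) ^ n)"
      using D by auto
    from zero_nhd_halve[OF this] obtain E where
      E: "open E" "0 \<in> E" "\<And>x. x \<in> E \<Longrightarrow> - x \<in> E"
         "\<And>x y. x \<in> E \<Longrightarrow> y \<in> E \<Longrightarrow> x + y \<in> D \<inter> ball 0 ((1 / 2) ^ n)"
      by metis
    from zero_nhd_halve[OF E(1,2)] obtain V where
      V: "open V" "0 \<in> V" "\<And>x. x \<in> V \<Longrightarrow> - x \<in> V" "\<And>x y. x \<in> V \<Longrightarrow> y \<in> V \<Longrightarrow> x + y \<in> E"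
      by metis
    from zero_nhd_halve[OF V(1,2)] obtain X where
      X: "open X" "0 \<in> X" "\<And>x y. x \<in> X \<Longrightarrow> y \<in> X \<Longrightarrow> x + y \<in> V"
      by metis
    have "open (X \<inter> T)" "0 \<in> X \<inter> T"
      using X that by (auto simp: P_def)
    from zero_nhd_halve[OF this] obtain T' where
      T': "open T'" "0 \<in> T'" "\<And>x y. x \<in> T' \<Longrightarrow> y \<in> T' \<Longrightarrow> x + y \<in> X \<inter> T"
      by metis
    have "a + b - (c + d) \<in> D" if "a \<in> V" "b \<in> V" "c \<in> V" "d \<in> V" for a b c d
      using E(4)[OF V(4)[OF that(1,2)] E(3)[OF V(4)[OF that(3,4)]]] by (simp add: algebra_simps)
    moreover have "a - b \<in> ball 0 ((1 / 2) ^ n)" if "a \<in> V" "b \<in> V" for a b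
      using E(4)[OF V(4)[OF that(1) V(3)[OF that(2)]] E(2)] by simp
    ultimately have "Q n T T' D V X"
      using D(3) V(1,2) X T'(3) unfolding Q_def P_def by (intro conjI ballI) blast+
    then show ?thesis
      using T'(1,2) P_def by blast
  qed
  have "P UNIV"
    by (simp add: P_def)
  then obtain T where T: "\<And>n. P (T n)" "\<And>n. \<exists>D V X. Q n (T n) (T (Suc n)) D V X"
    using dependent_nat_choice[of "\<lambda>n. P" "\<lambda>n T T'. \<exists>D V X. Q n T T' D V X"] step by blast
  then obtain D V X where Q: "\<And>n. Q n (T n) (T (Suc n)) (D n) (V n) (X n)"
    by metis
  show ?thesis
    by (rule that[of T V X D]) (use T(1) Q in \<open>auto simp: P_def Q_def uncovered_def\<close>)
qed

text \<open>
  Here \<open>t y\<close> is the sum of points \<open>g n (y n)\<close>, where \<open>g n\<close> is a sequence in a small neighbourhood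
  of \<open>0\<close> such that the sets \<open>g n k + Q k + V n + C\<close> are pairwise disjoint, for finite sets \<open>Q k\<close>
  increasing to a dense set. If \<open>K\<close> is compact and \<open>y\<close> grows fast enough, then \<open>y\<close> can be read off
  from any point of \<open>K + t y\<close>. The set \<open>J n k\<close> is \<open>Q k + V n\<close>.
\<close>

lemma separating_translations:
  fixes C :: "'a::{topological_ab_group_add, polish_space} set"
  assumes nlc: "\<not> locally_compact_space (euclidean :: 'a topology)" and C: "compact C"
  obtains t :: "(nat \<Rightarrow> nat) \<Rightarrow> 'a" and W :: "nat \<Rightarrow> (nat \<Rightarrow> nat) \<Rightarrow> 'a set"
    and J :: "nat \<Rightarrow> nat \<Rightarrow> 'a set"
  where "continuous_on UNIV t"
    "\<And>n y. open (W n y)"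
    "\<And>n y y'. (\<And>i. i \<le> n \<Longrightarrow> y i = y' i) \<Longrightarrow> W n y = W n y'"
    "\<And>n y y' h h' c c'. (\<And>m. m \<le> n \<Longrightarrow> h \<in> W m y) \<Longrightarrow> (\<And>m. m \<le> n \<Longrightarrow> h' \<in> W m y') \<Longrightarrow>
        h - h' = c - c' \<Longrightarrow> c \<in> C \<Longrightarrow> c' \<in> C \<Longrightarrow> y n = y' n"
    "\<And>n k. open (J n k)" "\<And>n k. 0 \<in> J n k" "\<And>n k k'. k \<le> k' \<Longrightarrow> J n k \<subseteq> J n k'"
    "\<And>K. compact K \<Longrightarrow> \<exists>r. \<forall>n. K \<subseteq> J n (r n)"
    "\<And>n y g. g \<in> J n (y n) \<Longrightarrow> g + t y \<in> W n y"
proof (rule separating_nhd_sequence[OF nlc])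
  fix T V X D :: "nat \<Rightarrow> 'a set"
  assume
    op: "\<And>n. open (T n)" "\<And>n. open (V n)" "\<And>n. open (X n)"
    and z: "\<And>n. 0 \<in> T n" "\<And>n. 0 \<in> V n" "\<And>n. 0 \<in> X n"
    and D: "\<And>n L. compact L \<Longrightarrow> \<exists>u\<in>T n. \<forall>l\<in>L. u - l \<notin> D n"
    and VD: "\<And>n a b c d. a \<in> V n \<Longrightarrow> b \<in> V n \<Longrightarrow> c \<in> V n \<Longrightarrow> d \<in> V n \<Longrightarrow> a + b - (c + d) \<in> D n"
    and Vball: "\<And>n a b. a \<in> V n \<Longrightarrow> b \<in> V n \<Longrightarrow> a - b \<in> ball 0 ((1 / 2) ^ n)"
    and XV: "\<And>n a b. a \<in> X n \<Longrightarrow> b \<in> X n \<Longrightarrow> a + b \<in> V n"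
    and TXT: "\<And>n a b. a \<in> T (Suc n) \<Longrightarrow> b \<in> T (Suc n) \<Longrightarrow> a + b \<in> X n \<inter> T n"
  obtain d :: "nat \<Rightarrow> 'a" where d: "\<And>U. open U \<Longrightarrow> U \<noteq> {} \<Longrightarrow> \<exists>i. d i \<in> U"
    using dense_sequence by blast
  define Q where "Q k = insert 0 (d ` {..k})" for k
  have Q_fin: "finite (Q k)" for k
    by (simp add: Q_def)
  \<comment> \<open>This is the recursive choice of \<open>g n k\<close>: up to \<open>D n\<close>
    it must avoid the compact sets \<open>g n j + Q j - Q k + C - C\<close> for all
    \<open>j < k\<close>.\<close>
  define far where "far n f k u \<longleftrightarrow> u \<in> T n \<and> (\<forall>j<k. \<forall>a\<in>Q k. \<forall>b\<in>Q j. \<forall>c\<in>C. \<forall>c'\<in>C.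
    u - (f j + b - a + c - c') \<notin> D n)" for n and f :: "nat \<Rightarrow> 'a" and k u
  have "\<exists>f. \<forall>k. far n f k (f k)" for n
  proof (rule dependent_wellorder_choice)
    fix u and f g :: "nat \<Rightarrow> 'a" and k :: nat assume "\<And>j. j < k \<Longrightarrow> f j = g j"
    then show "far n f k u = far n g k u"
      by (simp add: far_def)
  next
    fix k and f :: "nat \<Rightarrow> 'a"
    define L where "L = (\<Union>j\<in>{..<k}. \<Union>a\<in>Q k. \<Union>b\<in>Q j. (\<lambda>p. f j + b - a + fst p - snd p) ` (C \<times> C))"
    have "compact L"
      unfolding L_def
      by (intro compact_UN finite_lessThan Q_fin compact_continuous_image compact_Times C continuous_intros)
    from D[OF this, of n] obtain u where u: "u \<in> T n" "\<And>l. l \<in> L \<Longrightarrow> u - l \<notin> D n"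
      by blast
    have "f j + b - a + c - c' \<in> L" if "j < k" "a \<in> Q k" "b \<in> Q j" "c \<in> C" "c' \<in> C" for j a b c c'
      unfolding L_def using that by force
    then show "\<exists>r. far n f k r"
      using u by (auto simp: far_def)
  qed
  then obtain g where g: "\<And>n k. far n (g n) k (g n k)"
    by metis
  have gT: "g n k \<in> T n" for n k
    using g[of n k] by (simp add: far_def)
  define s where "s y n = (\<Sum>i<n. g i (y i))" for y n
  have s_cong: "s y n = s y' n" if "\<And>i. i < n \<Longrightarrow> y i = y' i" for y y' n
    using that by (simp add: s_def)
  \<comment> \<open>Backward induction on \<open>p\<close>: a sum of two points of
    \<open>T (Suc p)\<close> is a point of \<open>T p\<close>, so adding the summand
    \<open>g p (y p)\<close> gives again a sum of two points, now of \<open>T p\<close>.\<close>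
  have "\<exists>a\<in>T p. \<exists>b\<in>T p. s y m - s y p = a + b" if "p \<le> m" for y p m
    using that
  proof (induction rule: inc_induct)
    case base
    then show ?case
      using z(1)[of m] by force
  next
    case (step p)
    then obtain a b where ab: "a \<in> T (Suc p)" "b \<in> T (Suc p)" "s y m - s y (Suc p) = a + b"
      by blast
    have "s y m - s y p = g p (y p) + (a + b)"
      unfolding ab(3)[symmetric] by (simp add: s_def)
    then show ?case
      using gT[of p "y p"] TXT[OF ab(1,2)] by blast
  qed
  then have tailX: "s y m - s y (Suc n) \<in> X n" if "Suc n \<le> m" for y n m
    using TXT that by (metis IntD1)
  have XsubV: "a \<in> X n \<Longrightarrow> a \<in> V n" for a n
    using XV[of a n 0] z(3)[of n] by simp
  have "convergent (s y)" for y
  proof (rule group_Cauchy_convergent)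
    fix U :: "'a set" assume "open U" "0 \<in> U"
    then obtain n where n: "ball 0 ((1 / 2) ^ n) \<subseteq> U"
      by (rule open_contains_ball_half_power)
    have "s y m - s y m' \<in> U" if "m \<ge> Suc n" "m' \<ge> Suc n" for m m'
      using Vball[OF XsubV[OF tailX[OF that(1), of y]] XsubV[OF tailX[OF that(2), of y]]] n
      by (simp add: subset_iff)
    then show "\<exists>N. \<forall>m\<ge>N. \<forall>m'\<ge>N. s y m - s y m' \<in> U"
      by blast
  qed
  then have lim: "s y \<longlonglongrightarrow> lim (s y)" for y
    by (simp add: convergent_LIMSEQ_iff)
  define t where "t y = lim (s y)" for y
  have tV: "t y - s y (Suc n) \<in> V n" for y n
  proof -
    \<comment> \<open>A late partial sum is within \<open>X n\<close> of \<open>t y\<close>, and its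
      own tail after stage \<open>n\<close> lies in \<open>X n\<close>; together they give an
      element of \<open>V n\<close>.\<close>
    have "open ((\<lambda>u. t y - u) -` X n)"
      by (intro open_vimage op continuous_intros)
    then have "\<forall>\<^sub>F m in sequentially. s y m \<in> (\<lambda>u. t y - u) -` X n"
      using topological_tendstoD[OF lim[of y], folded t_def] z(3)[of n] by (metis diff_self vimage_eq)
    then have "\<forall>\<^sub>F m in sequentially. t y - s y m \<in> X n \<and> m \<ge> Suc n"
      using eventually_ge_at_top by (auto intro: eventually_conj)
    then obtain m where m: "t y - s y m \<in> X n" "m \<ge> Suc n"
      by (auto simp: eventually_sequentially)
    show ?thesis
      using XV[OF m(1) tailX[OF m(2), of y]] by simp
  qed
  \<comment> \<open>One summand from \<open>V n\<close> is the error allowed in \<open>J n\<close>,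
    the other is the tail \<open>t y - s y (Suc n)\<close>.\<close>
  define W where "W n y = {h. \<exists>q\<in>Q (y n). \<exists>a\<in>V n. \<exists>b\<in>V n. h = s y (Suc n) + q + a + b}" for n y
  define J where "J n k = {g. \<exists>q\<in>Q k. g - q \<in> V n}" for n k
  show ?thesis
  proof (rule that[of t W J])
    show "continuous_on UNIV t"
      unfolding continuous_on_topological
    proof (intro ballI allI impI)
      fix y and U :: "'a set" assume "open U" "t y \<in> U"
      then have "open {u. t y + u \<in> U}" "0 \<in> {u. t y + u \<in> U}"
        using open_translate_vimage by auto
      then obtain n where n: "ball 0 ((1 / 2) ^ n) \<subseteq> {u. t y + u \<in> U}"
        by (rule open_contains_ball_half_power)
      have "t y' \<in> U" if y': "\<And>i. i \<le> n \<Longrightarrow> y' i = y i" for y'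
      proof -
        have "s y' (Suc n) = s y (Suc n)"
          by (rule s_cong) (simp add: y')
        then have "t y' - t y \<in> ball 0 ((1 / 2) ^ n)"
          using Vball[OF tV[of y' n] tV[of y n]] by simp
        then have "t y' - t y \<in> {u. t y + u \<in> U}"
          using n by blast
        then show ?thesis
          by simp
      qed
      moreover have "open (\<Inter>i\<in>{..n}. {y'. y' i = y i})"
        by (intro open_INT ballI finite_atMost open_coordinate_eq)
      ultimately show "\<exists>A. open A \<and> y \<in> A \<and> (\<forall>y'\<in>UNIV. y' \<in> A \<longrightarrow> t y' \<in> U)"
        by (intro exI[of _ "\<Inter>i\<in>{..n}. {y'. y' i = y i}"]) auto
    qed
    show "open (W n y)" for n y
    proof -
      have "(\<exists>b\<in>V n. h = z + b) \<longleftrightarrow> h - z \<in> V n" for h z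
        by (metis add.commute add_diff_cancel_left' diff_add_cancel)
      then have "W n y = (\<Union>q\<in>Q (y n). \<Union>a\<in>V n. {h. h - (s y (Suc n) + q + a) \<in> V n})"
        unfolding W_def by blast
      then show ?thesis
        by (auto intro!: open_translate_vimage op)
    qed
    show "W n y = W n y'" if "\<And>i. i \<le> n \<Longrightarrow> y i = y' i" for n y y'
      using that s_cong[of "Suc n" y y'] by (simp add: W_def)
    show "open (J n k)" for n k
    proof -
      have "J n k = (\<Union>q\<in>Q k. {g. g - q \<in> V n})"
        unfolding J_def by auto
      then show ?thesis
        by (auto intro!: open_translate_vimage op)
    qed
    show "0 \<in> J n k" for n k
      using z(2) by (auto simp: J_def Q_def)
    show "J n k \<subseteq> J n k'" if "k \<le> k'" for n k k'
      using that by (auto simp: J_def Q_def)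
    show "\<exists>r. \<forall>n. K \<subseteq> J n (r n)" if K: "compact K" for K
    proof -
      have "\<exists>r. K \<subseteq> J n r" for n
      proof -
        have "K \<subseteq> (\<Union>i\<in>UNIV. {g. g - d i \<in> V n})"
        proof
          fix x
          have "open ((\<lambda>u. x - u) -` V n)"
            by (intro open_vimage op continuous_intros)
          moreover have "x \<in> (\<lambda>u. x - u) -` V n"
            using z(2) by simp
          ultimately show "x \<in> (\<Union>i\<in>UNIV. {g. g - d i \<in> V n})"
            using d by blast
        qed
        then obtain I where I: "finite I" "K \<subseteq> (\<Union>i\<in>I. {g. g - d i \<in> V n})"
          by (rule compactE_image[OF K open_translate_vimage(2)[OF op(2)]])
        obtain r where r: "I \<subseteq> {..r}"
          using I(1) by (meson atMost_iff finite_nat_set_iff_bounded_le subsetI)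
        have "K \<subseteq> J n r"
        proof
          fix x assume "x \<in> K"
          then obtain i where "i \<in> I" "x - d i \<in> V n"
            using I(2) by auto
          then show "x \<in> J n r"
            using r by (auto simp: J_def Q_def)
        qed
        then show ?thesis ..
      qed
      then show ?thesis
        by metis
    qed
    show "g + t y \<in> W n y" if gJ: "g \<in> J n (y n)" for n y g
    proof -
      obtain q where q: "q \<in> Q (y n)" "g - q \<in> V n"
        using gJ by (auto simp: J_def)
      have "g + t y = s y (Suc n) + q + (g - q) + (t y - s y (Suc n))"
        by simp
      then show ?thesis
        unfolding W_def using q tV by blast
    qed
    show "y n = y' n" if W: "\<And>m. m \<le> n \<Longrightarrow> h \<in> W m y" "\<And>m. m \<le> n \<Longrightarrow> h' \<in> W m y'"
        and c: "h - h' = c - c'" "c \<in> C" "c' \<in> C" for n y y' h h' c c'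
      using W
    proof (induction n rule: less_induct)
      case (less n)
      have eq: "s y n = s y' n"
        by (rule s_cong) (rule less.IH; use less.prems in simp)
      \<comment> \<open>If the earlier entries agree and \<open>y' n < y n\<close>, the relation
        between the points contradicts the choice of \<open>g n (y n)\<close>. The claim is stated
        for arbitrary points and codes so that it also applies with the two sides exchanged.\<close>
      have *: False if "h \<in> W n y" "h' \<in> W n y'" "y' n < y n" "s y n = s y' n"
        "h - h' = c - c'" "c \<in> C" "c' \<in> C" for h h' y y' c c'
      proof -
        obtain q a b where 1: "q \<in> Q (y n)" "a \<in> V n" "b \<in> V n" "h = s y (Suc n) + q + a + b"
          using \<open>h \<in> W n y\<close> by (auto simp: W_def)
        obtain q' a' b' where 2: "q' \<in> Q (y' n)" "a' \<in> V n" "b' \<in> V n" "h' = s y' (Suc n) + q' + a' + b'"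
          using \<open>h' \<in> W n y'\<close> by (auto simp: W_def)
        have "g n (y n) - (g n (y' n) + q' - q + c - c') = a' + b' - (a + b)"
          using 1(4) 2(4) \<open>h - h' = c - c'\<close> \<open>s y n = s y' n\<close> by (simp add: s_def algebra_simps)
        also have "\<dots> \<in> D n"
          by (intro VD 1 2)
        finally show False
          using g[of n "y n"] that 1 2 by (auto simp: far_def)
      qed
      have "h \<in> W n y" "h' \<in> W n y'"
        using less.prems by simp_all
      moreover have "h' - h = c' - c"
        using c(1) by (metis minus_diff_eq)
      ultimately show ?case
        using *[of h y h' y' c c'] *[of h' y' h y c' c] c eq by (metis linorder_neqE_nat)
    qed
  qed
qed

section \<open>Uniformization of sets with sections of positive measure\<close>

lemma measure_closed_open_approximation:
  fixes \<nu> :: "'a::polish_space measure"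
  assumes "finite_measure \<nu>" and \<nu>: "sets \<nu> = sets borel" and b: "b \<in> sets borel" and e: "e > 0"
  obtains k G where "closed k" "open G" "k \<subseteq> b" "b \<subseteq> G" "measure \<nu> (G - k) < e"
proof -
  interpret finite_measure \<nu> by fact
  have sb: "space \<nu> = UNIV"
    using sets_eq_imp_space_eq[OF \<nu>] by simp
  have "\<exists>k\<in>{K. K \<subseteq> b \<and> compact K}. emeasure \<nu> b < emeasure \<nu> k + ennreal (e / 2)"
    using e by (intro SUP_approx_ennreal inner_regular \<nu> b) (auto simp: sb emeasure_eq_measure)
  then obtain k where k: "k \<subseteq> b" "compact k" "emeasure \<nu> b < emeasure \<nu> k + ennreal (e / 2)"
    by blast
  have "\<exists>G\<in>{U. b \<subseteq> U \<and> open U}. emeasure \<nu> G < emeasure \<nu> b + ennreal (e / 2)"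
    using e by (intro INF_approx_ennreal outer_regular \<nu> b) (auto simp: sb emeasure_eq_measure)
  then obtain G where G: "b \<subseteq> G" "open G" "emeasure \<nu> G < emeasure \<nu> b + ennreal (e / 2)"
    by blast
  have "measure \<nu> b < measure \<nu> k + e / 2" "measure \<nu> G < measure \<nu> b + e / 2"
    using k(3) G(3) e by (simp_all add: emeasure_eq_measure ennreal_less_iff flip: ennreal_plus)
  moreover have "measure \<nu> (G - k) = measure \<nu> G - measure \<nu> k"
    using k G by (intro finite_measure_Diff) (auto simp: \<nu> compact_imp_closed)
  ultimately have "measure \<nu> (G - k) < e"
    by simp
  then show ?thesis
    using that[of k G] k G compact_imp_closed by blast
qed

lemma measurable_measure_section:
  assumes "finite_measure \<nu>" "sets \<nu> = sets borel" "Q \<in> sets (M \<Otimes>\<^sub>M borel)"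
  shows "(\<lambda>x. measure \<nu> (Pair x -` Q)) \<in> borel_measurable M"
proof -
  interpret finite_measure \<nu> by fact
  have "Q \<in> sets (M \<Otimes>\<^sub>M \<nu>)"
    using assms(2,3) by (simp cong: sets_pair_measure_cong)
  then show ?thesis
    unfolding measure_def by (intro borel_measurable_enn2real measurable_emeasure_Pair)
qed

text \<open>The sets with such approximations for every \<open>e\<close> form a sigma-algebra
  containing the rectangles. Complements exchange the closed and the open set. For unions the open
  sets are united, but closedness of sections survives only finite unions, whose length has to
  depend measurably on the point of \<open>M\<close>.\<close>

lemma section_closed_open_approximation:
  fixes \<nu> :: "'a::polish_space measure"
  assumes fin: "finite_measure \<nu>" and \<nu>: "sets \<nu> = sets borel"
    and P: "P \<in> sets (M \<Otimes>\<^sub>M borel)" and e: "e > 0"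
  shows "\<exists>K G. K \<in> sets (M \<Otimes>\<^sub>M borel) \<and> G \<in> sets (M \<Otimes>\<^sub>M borel) \<and> K \<subseteq> P \<and> P \<subseteq> G \<and>
    (\<forall>x\<in>space M. closed (Pair x -` K) \<and> open (Pair x -` G) \<and> measure \<nu> (Pair x -` (G - K)) < e)"
proof -
  interpret finite_measure \<nu> by fact
  have sec: "Pair x -` Q \<in> sets \<nu>" if "Q \<in> sets (M \<Otimes>\<^sub>M borel)" for x Q
    using sets_Pair1[OF that] \<nu> by simp
  define good where "good e P K G \<longleftrightarrow> K \<in> sets (M \<Otimes>\<^sub>M borel) \<and> G \<in> sets (M \<Otimes>\<^sub>M borel) \<and> K \<subseteq> P \<and> P \<subseteq> G \<and>
    (\<forall>x\<in>space M. closed (Pair x -` K) \<and> open (Pair x -` G) \<and> measure \<nu> (Pair x -` (G - K)) < e)" for e P K G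
  have "P \<in> sigma_sets (space M \<times> space borel) {a \<times> b | a b. a \<in> sets M \<and> b \<in> sets borel}"
    using P by (simp only: sets_pair_measure)
  then have "\<forall>e>0. \<exists>K G. good e P K G"
  proof (induction rule: sigma_sets.induct)
    case (Basic S)
    then obtain a b where S: "S = a \<times> b" "a \<in> sets M" "b \<in> sets borel"
      by blast
    show ?case
    proof (intro allI impI)
      fix e :: real assume e: "e > 0"
      obtain k G where kG: "closed k" "open G" "k \<subseteq> b" "b \<subseteq> G" "measure \<nu> (G - k) < e"
        using measure_closed_open_approximation[OF fin \<nu> S(3) e] .
      have "good e S (a \<times> k) (a \<times> G)"
        unfolding good_def
      proof (intro conjI ballI)
        fix x
        consider "x \<in> a" "Pair x -` (a \<times> k) = k" "Pair x -` (a \<times> G) = G" "Pair x -` (a \<times> G - a \<times> k) = G - k"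
          | "x \<notin> a" "Pair x -` (a \<times> k) = {}" "Pair x -` (a \<times> G) = {}" "Pair x -` (a \<times> G - a \<times> k) = {}"
          by blast
        then show "closed (Pair x -` (a \<times> k))" "open (Pair x -` (a \<times> G))"
          "measure \<nu> (Pair x -` (a \<times> G - a \<times> k)) < e"
          by (cases; use kG e in simp)+
      qed (use kG S in auto)
      then show "\<exists>K G. good e S K G"
        by blast
    qed
  next
    case Empty
    have "good e {} {} {}" if "e > 0" for e
      using that by (simp add: good_def)
    then show ?case
      by blast
  next
    case (Compl S)
    show ?case
    proof (intro allI impI)
      fix e :: real assume "e > 0"
      then obtain K G where KG: "good e S K G"
        using Compl by blast
      define Z where "Z = space M \<times> (UNIV :: 'a set)"
      have Z: "Z \<in> sets (M \<Otimes>\<^sub>M borel)"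
        unfolding Z_def by simp
      have sec': "Pair x -` (Z - G) = - (Pair x -` G)" "Pair x -` (Z - K) = - (Pair x -` K)" if "x \<in> space M" for x
        using that by (auto simp: Z_def)
      have "Pair x -` ((Z - K) - (Z - G)) = Pair x -` (G - K)" if "x \<in> space M" for x
        using that by (auto simp: Z_def)
      then have "good e (Z - S) (Z - G) (Z - K)"
        using KG Z sec' unfolding good_def by (auto simp: open_Compl closed_Compl)
      then show "\<exists>K G. good e (space M \<times> space borel - S) K G"
        by (auto simp: Z_def)
    qed
  next
    case (Union S)
    show ?case
    proof (intro allI impI)
      fix e :: real assume e: "e > 0"
      have "\<forall>n. \<exists>K G. good (e / 2 * (1 / 2) ^ Suc n) (S n) K G"
        using Union e by simp
      then obtain K G where KG: "\<And>n. good (e / 2 * (1 / 2) ^ Suc n) (S n) (K n) (G n)"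
        by metis
      then have meas [measurable]: "K n \<in> sets (M \<Otimes>\<^sub>M borel)" "G n \<in> sets (M \<Otimes>\<^sub>M borel)" for n
        by (auto simp: good_def)
      define R where "R x N = measure \<nu> (Pair x -` ((\<Union>n. K n) - (\<Union>n<N. K n)))" for x N
      have R_meas [measurable]: "(\<lambda>x. R x N) \<in> borel_measurable M" for N
        unfolding R_def by (intro measurable_measure_section fin \<nu>) auto
      have R_ex: "\<exists>N. R x N < e / 2" for x
      proof -
        have "(\<lambda>N. measure \<nu> (Pair x -` ((\<Union>n. K n) - (\<Union>n<N. K n))))
          \<longlonglongrightarrow> measure \<nu> (\<Inter>N. Pair x -` ((\<Union>n. K n) - (\<Union>n<N. K n)))"
          by (intro finite_Lim_measure_decseq) (auto intro!: sec simp: decseq_def)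
        moreover have "(\<Inter>N. Pair x -` ((\<Union>n. K n) - (\<Union>n<N. K n))) = {}"
          by auto
        ultimately have "(\<lambda>N. R x N) \<longlonglongrightarrow> 0"
          by (simp add: R_def)
        then have "\<forall>\<^sub>F N in sequentially. R x N < e / 2"
          using e by (intro order_tendstoD(2)[of _ 0]) auto
        then show ?thesis
          by (auto simp: eventually_sequentially)
      qed
      \<comment> \<open>The first \<open>N x\<close> closed sections exhaust the union of all of
        them up to \<open>e / 2\<close>; the other half of \<open>e\<close> is spent on the
        differences \<open>G n - K n\<close>.\<close>
      define N where "N x = (LEAST N. R x N < e / 2)" for x
      have N: "R x (N x) < e / 2" for x
        unfolding N_def by (rule LeastI_ex[OF R_ex])
      have N_meas [measurable]: "N \<in> M \<rightarrow>\<^sub>M count_space UNIV"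
        unfolding N_def by measurable
      define K' where "K' = (\<Union>n. K n \<inter> ({x\<in>space M. n < N x} \<times> UNIV))"
      have "K' \<in> sets (M \<Otimes>\<^sub>M borel)"
      proof -
        have "{x\<in>space M. n < N x} \<in> sets M" for n
          by measurable
        then show ?thesis
          unfolding K'_def by (intro sets.countable_UN sets.Int pair_measureI subsetI) auto
      qed
      moreover have "K' \<subseteq> (\<Union>n. S n)" "(\<Union>n. S n) \<subseteq> (\<Union>n. G n)" "(\<Union>n. G n) \<in> sets (M \<Otimes>\<^sub>M borel)"
        using KG unfolding K'_def good_def by blast+
      moreover have "closed (Pair x -` K')" "open (Pair x -` (\<Union>n. G n))"
        "measure \<nu> (Pair x -` ((\<Union>n. G n) - K')) < e" if x: "x \<in> space M" for x
      proof -
        have eq: "Pair x -` K' = (\<Union>n<N x. Pair x -` K n)"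
          using x by (auto simp: K'_def)
        show "closed (Pair x -` K')"
          unfolding eq using KG x by (auto simp: good_def)
        show "open (Pair x -` (\<Union>n. G n))"
          unfolding vimage_UN using KG x by (auto simp: good_def)
        define A where "A n = Pair x -` (G n - K n)" for n
        have A: "measure \<nu> (A n) \<le> e / 2 * (1 / 2) ^ Suc n" for n
          using KG[of n] x by (auto simp: good_def A_def intro: less_imp_le)
        have A_sets: "A n \<in> sets \<nu>" for n
          unfolding A_def by (intro sec sets.Diff meas)
        have s: "(\<lambda>n. e / 2 * (1 / 2) ^ Suc n) sums (e / 2 * 1)"
          by (intro sums_mult power_half_series)
        have sA: "summable (\<lambda>n. measure \<nu> (A n))"
          by (rule summable_comparison_test[OF _ sums_summable[OF s]]) (use A in auto)
        have "measure \<nu> (\<Union>n. A n) \<le> (\<Sum>n. measure \<nu> (A n))"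
          by (intro finite_measure_subadditive_countably sA) (use A_sets in auto)
        also have "\<dots> \<le> e / 2"
          using suminf_le[OF A sA sums_summable[OF s]] sums_unique[OF s] by simp
        finally have 1: "measure \<nu> (\<Union>n. A n) \<le> e / 2" .
        have B_sets: "Pair x -` ((\<Union>n. K n) - (\<Union>n<N x. K n)) \<in> sets \<nu>"
          by (intro sec) auto
        have "Pair x -` ((\<Union>n. G n) - K') \<subseteq> (\<Union>n. A n) \<union> Pair x -` ((\<Union>n. K n) - (\<Union>n<N x. K n))"
          unfolding vimage_Diff eq by (auto simp: A_def)
        then have "measure \<nu> (Pair x -` ((\<Union>n. G n) - K'))
            \<le> measure \<nu> ((\<Union>n. A n) \<union> Pair x -` ((\<Union>n. K n) - (\<Union>n<N x. K n)))"
          using A_sets B_sets by (intro finite_measure_mono) auto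
        also have "\<dots> \<le> measure \<nu> (\<Union>n. A n) + measure \<nu> (Pair x -` ((\<Union>n. K n) - (\<Union>n<N x. K n)))"
          using A_sets B_sets by (intro measure_Un_le) auto
        also have "\<dots> < e"
          using 1 N[of x] by (simp add: R_def)
        finally show "measure \<nu> (Pair x -` ((\<Union>n. G n) - K')) < e" .
      qed
      ultimately have "good e (\<Union>n. S n) K' (\<Union>n. G n)"
        unfolding good_def by blast
      then show "\<exists>K G. good e (\<Union>n. S n) K G"
        by blast
    qed
  qed
  then show ?thesis
    using e unfolding good_def by blast
qed

text \<open>On a set with closed sections, the essential infimum of the section is a measurable selector.\<close>

lemma borel_uniformization_positive_measure:
  fixes \<nu> :: "real measure"
  assumes fin: "finite_measure \<nu>" and \<nu>: "sets \<nu> = sets borel"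
    and P: "P \<in> sets (M \<Otimes>\<^sub>M borel)" and bdd: "\<And>x w. (x, w) \<in> P \<Longrightarrow> 0 \<le> w \<and> w \<le> 1"
  shows "\<exists>z\<in>borel_measurable M. \<forall>x\<in>space M. 0 < measure \<nu> (Pair x -` P) \<longrightarrow> (x, z x) \<in> P"
proof -
  interpret finite_measure \<nu> by fact
  have sec: "Pair x -` Q \<in> sets \<nu>" if "Q \<in> sets (M \<Otimes>\<^sub>M borel)" for x Q
    using sets_Pair1[OF that] \<nu> by simp
  have "\<forall>n. \<exists>K. K \<in> sets (M \<Otimes>\<^sub>M borel) \<and> K \<subseteq> P \<and>
    (\<forall>x\<in>space M. closed (Pair x -` K) \<and> measure \<nu> (Pair x -` (P - K)) < (1 / 2) ^ n)"
  proof
    fix n :: nat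
    from section_closed_open_approximation[OF fin \<nu> P, of "(1 / 2) ^ n"] obtain K G where
      KG: "K \<in> sets (M \<Otimes>\<^sub>M borel)" "G \<in> sets (M \<Otimes>\<^sub>M borel)" "K \<subseteq> P" "P \<subseteq> G"
      "\<And>x. x \<in> space M \<Longrightarrow> closed (Pair x -` K)" "\<And>x. x \<in> space M \<Longrightarrow> measure \<nu> (Pair x -` (G - K)) < (1 / 2) ^ n"
      by auto
    have "measure \<nu> (Pair x -` (P - K)) < (1 / 2) ^ n" if "x \<in> space M" for x
      by (rule le_less_trans[OF finite_measure_mono KG(6)[OF that]]) (use KG(1-4) in \<open>auto intro!: sec\<close>)
    then show "\<exists>K. K \<in> sets (M \<Otimes>\<^sub>M borel) \<and> K \<subseteq> P \<and>
      (\<forall>x\<in>space M. closed (Pair x -` K) \<and> measure \<nu> (Pair x -` (P - K)) < (1 / 2) ^ n)"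
      using KG by blast
  qed
  then obtain K where K: "\<And>n. K n \<in> sets (M \<Otimes>\<^sub>M borel)" "\<And>n. K n \<subseteq> P"
    "\<And>n x. x \<in> space M \<Longrightarrow> closed (Pair x -` K n)"
    "\<And>n x. x \<in> space M \<Longrightarrow> measure \<nu> (Pair x -` (P - K n)) < (1 / 2) ^ n"
    by metis
  define m where "m n q x = measure \<nu> (Pair x -` (K n \<inter> (space M \<times> {..q})))" for n x and q :: real
  have m_meas [measurable]: "m n q \<in> borel_measurable M" for n q
    unfolding m_def by (intro measurable_measure_section fin \<nu> sets.Int K(1) pair_measureI) auto
  have m_eq: "m n q x = measure \<nu> (Pair x -` K n \<inter> {..q})" if "x \<in> space M" for n q x
    unfolding m_def by (rule arg_cong[of _ _ "measure \<nu>"]) (use that in auto)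
  \<comment> \<open>The bounds run over the rationals, so the infimum is countable and therefore
    measurable.\<close>
  define z where "z n x = (INF q\<in>\<rat>. if 0 < m n q x then ereal q else \<infinity>)" for n x
  have z_meas: "(\<lambda>x. real_of_ereal (z n x)) \<in> borel_measurable M" for n
  proof -
    have "(\<lambda>x. if 0 < m n q x then ereal q else \<infinity>) \<in> borel_measurable M" for q
      by measurable
    then have "z n \<in> borel_measurable M"
      unfolding z_def using countable_rat by (intro borel_measurable_INF) auto
    then show ?thesis
      by measurable
  qed
  have z_in: "(x, real_of_ereal (z n x)) \<in> K n" if x: "x \<in> space M" and pos: "0 < measure \<nu> (Pair x -` K n)" for n x
  proof -
    have lo: "0 \<le> q" if "0 < m n q x" for q
    proof (rule ccontr)
      assume "\<not> 0 \<le> q"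
      then have "Pair x -` K n \<inter> {..q} = {}"
        using bdd K(2)[of n] by force
      then show False
        using that m_eq[OF x] by simp
    qed
    have "Pair x -` K n \<inter> {..1} = Pair x -` K n"
      using bdd K(2)[of n] by blast
    then have "0 < m n 1 x"
      using pos m_eq[OF x] by simp
    then have "z n x \<le> ereal 1"
      unfolding z_def by (intro INF_lower2[of 1]) auto
    moreover have "0 \<le> z n x"
      unfolding z_def using lo by (intro INF_greatest) auto
    ultimately obtain r where r: "z n x = ereal r"
      by (cases "z n x") auto
    \<comment> \<open>Cut off at a rational below \<open>r\<close> the section has measure zero, cut
      off slightly above \<open>r\<close> it has positive measure. Hence it has points arbitrarily
      close to \<open>r\<close>, and closedness puts \<open>r\<close> in it.\<close>
    have "\<exists>w\<in>Pair x -` K n. dist w r < \<delta>" if \<delta>: "\<delta> > 0" for \<delta>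
    proof -
      have "z n x < ereal (r + \<delta>)"
        using r that by simp
      then obtain q where q: "q < r + \<delta>" "0 < m n q x"
        unfolding z_def INF_less_iff by (auto split: if_splits)
      obtain p where p: "p \<in> \<rat>" "r - \<delta> < p" "p < r"
        using Rats_dense_in_real[of "r - \<delta>" r] \<delta> by auto
      have "\<not> 0 < m n p x"
      proof
        assume "0 < m n p x"
        then have "z n x \<le> ereal p"
          unfolding z_def by (intro INF_lower2[OF p(1)]) simp
        then show False
          using r p by simp
      qed
      then have "Pair x -` K n \<inter> {..q} \<noteq> Pair x -` K n \<inter> {..p}"
        using q(2) m_eq[OF x] by metis
      moreover have "Pair x -` K n \<inter> {..p} \<subseteq> Pair x -` K n \<inter> {..q}" if "p \<le> q"
        using that by auto
      moreover have "m n q x \<le> m n p x" if "q \<le> p"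
        unfolding m_eq[OF x] using that K(1)[of n]
        by (intro finite_measure_mono) (auto intro!: sets.Int sec simp: \<nu>)
      ultimately obtain w where "w \<in> Pair x -` K n" "p < w" "w \<le> q"
        using q(2) \<open>\<not> 0 < m n p x\<close> by (smt (verit) Int_iff atMost_iff subsetI subset_antisym)
      then show ?thesis
        using p q by (intro bexI[of _ w]) (auto simp: dist_real_def)
    qed
    then have "r \<in> Pair x -` K n"
      using K(3)[OF x, of n] by (metis closed_approachable)
    then show ?thesis
      using r by simp
  qed
  \<comment> \<open>Sections lie in \<open>[0, 1]\<close>, so \<open>m n 1 x\<close> is the full
    measure of the section of \<open>K n\<close>. Where the section of \<open>P\<close> has positive
    measure, some \<open>n\<close> qualifies because \<open>K n\<close> misses less than
    \<open>(1 / 2) ^ n\<close> of it.\<close>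
  define N where "N x = (LEAST n. 0 < m n 1 x)" for x
  have N_meas: "N \<in> M \<rightarrow>\<^sub>M count_space UNIV"
    unfolding N_def by measurable
  have "(x, real_of_ereal (z (N x) x)) \<in> P" if x: "x \<in> space M" and pos: "0 < measure \<nu> (Pair x -` P)" for x
  proof -
    have K1: "Pair x -` K n \<inter> {..1} = Pair x -` K n" for n
      using bdd K(2)[of n] by blast
    obtain n where n: "(1 / 2) ^ n < measure \<nu> (Pair x -` P)"
      using real_arch_pow_inv[OF pos, of "1 / 2"] by auto
    have "measure \<nu> (Pair x -` P) \<le> measure \<nu> (Pair x -` (P - K n) \<union> Pair x -` K n)"
      using K(1)[of n] P by (intro finite_measure_mono) (auto intro!: sec sets.Un)
    also have "\<dots> \<le> measure \<nu> (Pair x -` (P - K n)) + measure \<nu> (Pair x -` K n)"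
      using K(1)[of n] P by (intro measure_Un_le) (auto intro!: sec)
    finally have "0 < m n 1 x"
      using K(4)[OF x, of n] n m_eq[OF x] K1 by simp
    then have "0 < m (N x) 1 x"
      unfolding N_def by (rule LeastI)
    then have "(x, real_of_ereal (z (N x) x)) \<in> K (N x)"
      using z_in[OF x] m_eq[OF x] K1 by simp
    then show ?thesis
      using K(2) by blast
  qed
  moreover have "(\<lambda>x. real_of_ereal (z (N x) x)) \<in> borel_measurable M"
    by (rule measurable_compose_countable[OF z_meas N_meas])
  ultimately show ?thesis
    by (intro bexI[of _ "\<lambda>x. real_of_ereal (z (N x) x)"] ballI impI)
qed

section \<open>Parametrization of probability measures\<close>

text \<open>The map \<open>r \<mapsto> frac (3 * r)\<close> shifts ternary digits; as only the digits \<open>0\<close> and \<open>1\<close> occur,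
  the expansion is unique.\<close>

lemma ternary_digit:
  fixes A :: "nat set"
  shows "1 \<le> 3 * ((\<lambda>r. frac (3 * r)) ^^ n) (\<Sum>i. of_bool (i \<in> A) * (1 / 3 :: real) ^ Suc i) \<longleftrightarrow> n \<in> A"
proof -
  define c where "c i = (of_bool (i \<in> A) :: real)" for i
  define x where "x n = (\<Sum>i. c (i + n) * (1 / 3) ^ Suc i)" for n
  have geo: "(\<lambda>i. (1 / 3 :: real) ^ Suc i) sums (1 / 2)"
    using sums_mult[OF geometric_sums[of "1 / 3 :: real"], of "1 / 3"] by simp
  have le: "0 \<le> c (i + n) * (1 / 3) ^ Suc i" "c (i + n) * (1 / 3) ^ Suc i \<le> (1 / 3) ^ Suc i" for i n
    by (auto simp: c_def)
  have sm: "summable (\<lambda>i. c (i + n) * (1 / 3) ^ Suc i)" for n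
    by (rule summable_comparison_test[OF _ sums_summable[OF geo]]) (use le in auto)
  have x0: "0 \<le> x n" for n
    unfolding x_def by (intro suminf_nonneg sm le)
  have x1: "x n \<le> 1 / 2" for n
    unfolding x_def sums_unique[OF geo] by (intro suminf_le le sm sums_summable[OF geo])
  \<comment> \<open>As \<open>c n\<close> is 0 or 1 and the tail lies in \<open>[0, 1 / 2]\<close>,
    the digit \<open>c n\<close> is the integer part of \<open>3 * x n\<close> and
    \<open>x (Suc n)\<close> its fractional part.\<close>
  have step: "3 * x n = c n + x (Suc n)" for n
  proof -
    have "x (Suc n) = (\<Sum>i. 3 * (c (Suc i + n) * (1 / 3) ^ Suc (Suc i)))"
      unfolding x_def by (rule arg_cong[of _ _ suminf]) auto
    also have "\<dots> = 3 * (\<Sum>i. c (Suc i + n) * (1 / 3) ^ Suc (Suc i))"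
      by (intro suminf_mult) (subst summable_Suc_iff[of "\<lambda>i. c (i + n) * (1 / 3) ^ Suc i"], rule sm)
    also have "\<dots> = 3 * (x n - c n / 3)"
      unfolding x_def by (subst suminf_split_head[OF sm]) simp
    finally show ?thesis
      by simp
  qed
  have "((\<lambda>r. frac (3 * r)) ^^ n) (x 0) = x n"
  proof (induction n)
    case (Suc n)
    have "frac (3 * x n) = x (Suc n)"
      unfolding frac_unique_iff using step[of n] x0[of "Suc n"] x1[of "Suc n"] by (auto simp: c_def)
    then show ?case
      using Suc by simp
  qed simp
  moreover have "1 \<le> 3 * x n \<longleftrightarrow> n \<in> A"
    using step[of n] x0[of "Suc n"] x1[of "Suc n"] by (auto simp: c_def)
  ultimately show ?thesis
    by (simp add: x_def c_def)
qed

text \<open>The ternary digits of \<open>j g\<close> record which balls around a dense sequence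
  contain \<open>g\<close>. From them \<open>k\<close> reads off, for each \<open>m\<close>, the
  first centre within \<open>(1 / 2) ^ m\<close> of \<open>g\<close>, and takes the limit of these
  centres.\<close>

lemma borel_embedding_in_real:
  obtains j :: "'a::polish_space \<Rightarrow> real" and k :: "real \<Rightarrow> 'a"
  where "j \<in> borel_measurable borel" "k \<in> borel_measurable borel" "\<And>g. k (j g) = g"
proof -
  obtain e :: "nat \<Rightarrow> 'a" where e: "\<And>U. open U \<Longrightarrow> U \<noteq> {} \<Longrightarrow> \<exists>i. e i \<in> U"
    using dense_sequence by blast
  define U where "U n = (case prod_decode n of (i, m) \<Rightarrow> ball (e i) ((1 / 2) ^ m))" for n
  define j where "j g = (\<Sum>n. of_bool (n \<in> {n. g \<in> U n}) * (1 / 3 :: real) ^ Suc n)" for g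
  have [measurable]: "U n \<in> sets borel" for n
    by (auto simp: U_def split: prod.split)
  have j: "j \<in> borel_measurable borel"
    unfolding j_def of_bool_def by measurable
  define T where "T n = (\<lambda>r :: real. frac (3 * r)) ^^ n" for n
  have [measurable]: "T n \<in> borel_measurable borel" for n
    unfolding T_def by (induction n) (simp_all add: frac_def)
  have digit: "1 \<le> 3 * T n (j g) \<longleftrightarrow> g \<in> U n" for n g
    unfolding T_def j_def ternary_digit by simp
  define L where "L m r = (LEAST i. 1 \<le> 3 * T (prod_encode (i, m)) r)" for m r
  have L [measurable]: "L m \<in> borel \<rightarrow>\<^sub>M count_space UNIV" for m
    unfolding L_def by measurable
  define f where "f m r = e (L m r)" for m r
  have f [measurable]: "f m \<in> borel_measurable borel" for m
    unfolding f_def by (rule measurable_compose[OF L]) simp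
  \<comment> \<open>Outside the range of \<open>j\<close> the centres may fail to converge; the
    constant value \<open>e 0\<close> there makes the limit exist everywhere.\<close>
  define f' where "f' m r = (if Cauchy (\<lambda>m. f m r) then f m r else e 0)" for m r
  define k where "k r = lim (\<lambda>m. f' m r)" for r
  have "k \<in> borel_measurable borel"
  proof (rule borel_measurable_LIMSEQ_metric)
    show "f' m \<in> borel_measurable borel" for m
      unfolding f'_def by measurable
    have "convergent (\<lambda>m. f' m r)" for r
      unfolding f'_def by (cases "Cauchy (\<lambda>m. f m r)") (simp_all add: Cauchy_convergent convergent_const)
    then show "(\<lambda>m. f' m r) \<longlonglongrightarrow> k r" for r
      by (simp add: k_def convergent_LIMSEQ_iff)
  qed
  moreover have "k (j g) = g" for g
  proof -
    have d: "dist (f m (j g)) g < (1 / 2) ^ m" for m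
    proof -
      obtain i where "e i \<in> ball g ((1 / 2) ^ m)"
        using e[of "ball g ((1 / 2) ^ m)"] by (auto simp: not_le)
      then have "1 \<le> 3 * T (prod_encode (i, m)) (j g)"
        unfolding digit by (simp add: U_def dist_commute)
      then have "1 \<le> 3 * T (prod_encode (L m (j g), m)) (j g)"
        unfolding L_def by (rule LeastI)
      then show ?thesis
        unfolding digit by (simp add: U_def f_def)
    qed
    have lim: "(\<lambda>m. f m (j g)) \<longlonglongrightarrow> g"
    proof (subst tendsto_dist_iff, rule tendsto_sandwich[OF _ _ tendsto_const LIMSEQ_realpow_zero])
      show "\<forall>\<^sub>F m in sequentially. dist (f m (j g)) g \<le> (1 / 2) ^ m"
        by (intro always_eventually allI less_imp_le d)
    qed auto
    then have "Cauchy (\<lambda>m. f m (j g))"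
      by (rule LIMSEQ_imp_Cauchy)
    then show ?thesis
      using lim by (simp add: k_def f'_def limI)
  qed
  ultimately show ?thesis
    using that j by blast
qed

text \<open>The uniform law on the open unit interval, pushed forward along the identity to become a
  measure on the Borel sets of the whole line.\<close>

definition unit_measure :: "real measure" where
  "unit_measure = distr (restrict_space lborel {0<..<1}) borel (\<lambda>x. x)"

lemma measurable_unit_restrict: "f \<in> borel_measurable borel \<Longrightarrow> f \<in> borel_measurable (restrict_space lborel {0<..<1 :: real})"
  by (rule measurable_restrict_space1) simp

lemma sets_unit_measure [simp, measurable_cong]: "sets unit_measure = sets borel"
  by (simp add: unit_measure_def)

lemma emeasure_unit_measure:
  "A \<in> sets borel \<Longrightarrow> emeasure unit_measure A = emeasure lborel (A \<inter> {0<..<1})"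
  unfolding unit_measure_def
  by (subst emeasure_distr)
     (auto simp: measurable_unit_restrict emeasure_restrict_space space_restrict_space Int_commute)

lemma prob_space_unit_measure: "prob_space unit_measure"
proof
  show "emeasure unit_measure (space unit_measure) = 1"
    using emeasure_unit_measure[of UNIV] by (simp add: unit_measure_def)
qed

lemma distr_unit_measure:
  "f \<in> borel_measurable borel \<Longrightarrow> distr unit_measure borel f = distr (restrict_space lborel {0<..<1}) borel f"
  unfolding unit_measure_def by (subst distr_distr) (auto simp: measurable_unit_restrict o_def)

text \<open>The laws on \<open>\<real>\<close> are coded by the sets of rational pairs \<open>(a, b)\<close> with \<open>F b \<le> a\<close>, where \<open>F\<close> is
  the distribution function; the quantile function at \<open>w\<close> is the supremum of all \<open>b\<close> with \<open>a < w\<close>.\<close>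

lemma universal_random_variable:
  obtains \<phi> :: "(nat \<Rightarrow> nat) \<Rightarrow> real \<Rightarrow> 'a::polish_space"
  where "(\<lambda>p. \<phi> (fst p) (snd p)) \<in> borel_measurable (borel \<Otimes>\<^sub>M borel)"
    "\<And>\<mu>. prob_space \<mu> \<Longrightarrow> sets \<mu> = sets borel \<Longrightarrow> \<exists>q. distr unit_measure borel (\<phi> q) = \<mu>"
proof -
  obtain j :: "'a \<Rightarrow> real" and k :: "real \<Rightarrow> 'a" where
    jk [measurable]: "j \<in> borel_measurable borel" "k \<in> borel_measurable borel" and kj: "\<And>g. k (j g) = g"
    using borel_embedding_in_real by metis
  define a b where "a n = real_of_rat (fst (from_nat n :: rat \<times> rat))"
    and "b n = real_of_rat (snd (from_nat n :: rat \<times> rat))" for n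
  define \<psi> where "\<psi> q w = (SUP n. if q n = 0 \<and> a n < w then ereal (b n) else - \<infinity>)"
    for q :: "nat \<Rightarrow> nat" and w :: real
  have \<psi>_meas [measurable]: "(\<lambda>p. \<psi> (fst p) (snd p)) \<in> borel_measurable (borel \<Otimes>\<^sub>M borel)"
  proof -
    have "(\<lambda>p. if fst p n = (0 :: nat) \<and> a n < snd p then ereal (b n) else - \<infinity>)
      \<in> borel_measurable (borel \<Otimes>\<^sub>M borel)" for n
    proof (rule measurable_If)
      have "{q :: nat \<Rightarrow> nat. q n = 0} \<times> {a n<..} \<in> sets (borel \<Otimes>\<^sub>M borel)"
        by (intro pair_measureI borel_open open_coordinate_eq open_greaterThan)
      also have "{q :: nat \<Rightarrow> nat. q n = 0} \<times> {a n<..}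
          = {p \<in> space (borel \<Otimes>\<^sub>M borel). fst p n = (0 :: nat) \<and> a n < snd p}"
        by (auto simp: space_pair_measure)
      finally show "{p \<in> space (borel \<Otimes>\<^sub>M borel). fst p n = (0 :: nat) \<and> a n < snd p}
          \<in> sets (borel \<Otimes>\<^sub>M borel)" .
    qed auto
    then show ?thesis
      unfolding \<psi>_def by (intro borel_measurable_SUP) auto
  qed
  define \<phi> where "\<phi> q w = k (real_of_ereal (\<psi> q w))" for q w
  have \<phi>: "(\<lambda>p. \<phi> (fst p) (snd p)) \<in> borel_measurable (borel \<Otimes>\<^sub>M borel)"
    unfolding \<phi>_def by measurable
  have "\<exists>q. distr unit_measure borel (\<phi> q) = \<mu>" if "prob_space \<mu>" and \<mu> [measurable_cong]: "sets \<mu> = sets borel" for \<mu>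
  proof -
    interpret \<mu>: prob_space \<mu> by fact
    have [measurable]: "j \<in> borel_measurable \<mu>"
      by measurable
    \<comment> \<open>The law of \<open>j\<close> under \<mu> lives on the line, with distribution
      function \<open>M.C\<close> and quantile function \<open>M.I\<close>. The quantile function
      carries the uniform law to it, and \<open>k\<close> carries it back to \<mu>.\<close>
    interpret M: cdf_distribution "distr \<mu> borel j"
      unfolding cdf_distribution_def by (rule \<mu>.real_distribution_distr) measurable
    define q where "q n = (if M.C (b n) \<le> a n then 0 else 1 :: nat)" for n
    have quant: "\<psi> q w = ereal (M.I w)" if w: "w \<in> {0<..<1}" for w
    proof (rule antisym)
      show "\<psi> q w \<le> ereal (M.I w)"
        unfolding \<psi>_def
      proof (rule SUP_least)
        fix n
        have "b n \<le> M.I w" if "M.C (b n) \<le> a n" "a n < w"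
          using M.pseudoinverse[of w "b n"] that w by auto
        then show "(if q n = 0 \<and> a n < w then ereal (b n) else - \<infinity>) \<le> ereal (M.I w)"
          by (auto simp: q_def)
      qed
      show "ereal (M.I w) \<le> \<psi> q w"
      proof (rule dense_le)
        fix z assume z: "z < ereal (M.I w)"
        show "z \<le> \<psi> q w"
        proof (cases z)
          case (real r)
          then obtain c where c: "r < of_rat c" "of_rat c < M.I w"
            using z of_rat_dense by auto
          then have "M.C (of_rat c) < w"
            using M.pseudoinverse[of w "of_rat c"] w by auto
          then obtain d where d: "M.C (of_rat c) < of_rat d" "of_rat d < w"
            using of_rat_dense by blast
          define n where "n = to_nat (d, c)"
          have n: "a n = of_rat d" "b n = of_rat c"
            by (simp_all add: a_def b_def n_def)
          then have "ereal (of_rat c) = (if q n = 0 \<and> a n < w then ereal (b n) else - \<infinity>)"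
            using d by (simp add: q_def)
          also have "\<dots> \<le> \<psi> q w"
            unfolding \<psi>_def by (rule SUP_upper) simp
          finally show ?thesis
            using c real by (meson ereal_less_le less_eq_ereal_def less_ereal.simps(1) order_trans)
        qed (use z in auto)
      qed
    qed
    have \<phi>q [measurable]: "\<phi> q \<in> borel_measurable borel"
      using measurable_compose[OF measurable_Pair1' \<phi>, of q] by simp
    have "distr unit_measure borel (\<phi> q) = distr (restrict_space lborel {0<..<1}) borel (\<phi> q)"
      by (rule distr_unit_measure) measurable
    also have "\<dots> = distr (restrict_space lborel {0<..<1}) borel (\<lambda>w. k (M.I w))"
      by (rule distr_cong) (auto simp: space_restrict_space \<phi>_def quant)
    also have "\<dots> = distr (distr (restrict_space lborel {0<..<1}) borel M.I) borel k"
      by (subst distr_distr) (auto simp: o_def jk cong: measurable_cong_sets)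
    also have "\<dots> = distr (distr \<mu> borel j) borel k"
      unfolding M.distr_I_eq_M ..
    also have "\<dots> = distr \<mu> borel (\<lambda>g. g)"
      by (subst distr_distr) (auto simp: o_def kj)
    also have "\<dots> = \<mu>"
      by (rule distr_id2) (simp add: \<mu>)
    finally show ?thesis
      by blast
  qed
  then show ?thesis
    using that \<phi> by blast
qed

section \<open>The Haar null set\<close>

lemma compact_prod_atMost: "compact {y :: nat \<Rightarrow> nat. \<forall>n. y n \<le> b n}"
proof -
  have "compactin (product_topology (\<lambda>i. euclidean) UNIV) (PiE UNIV (\<lambda>n. {..b n}))"
    unfolding compactin_PiE by (simp add: finite_imp_compact)
  moreover have "PiE UNIV (\<lambda>n. {..b n}) = {y. \<forall>n. y n \<le> b n}"
    by auto
  ultimately show ?thesis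
    by (simp add: euclidean_product_topology)
qed

text \<open>Separation with the compact set \<open>{0}\<close> makes \<open>t\<close> a continuous
  injection of the Baire space. The set \<open>C\<close> is the image of a compact product of finite
  sets, and the uniform law is carried into it by way of dyadic approximations. These determine the
  point of the interval, so there are no atoms.\<close>

lemma ex_atomless_measure_on_compact:
  assumes nlc: "\<not> locally_compact_space (euclidean :: 'a::{topological_ab_group_add, polish_space} topology)"
  obtains C :: "'a::{topological_ab_group_add, polish_space} set" and \<nu> :: "'a measure"
  where "compact C" "C \<noteq> {}" "prob_space \<nu>" "sets \<nu> = sets borel"
    "emeasure \<nu> (- C) = 0" "\<And>x. emeasure \<nu> {x} = 0"
proof (rule separating_translations[OF nlc, of "{0}"])
  fix t :: "(nat \<Rightarrow> nat) \<Rightarrow> 'a" and W and J :: "nat \<Rightarrow> nat \<Rightarrow> 'a set"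
  assume t: "continuous_on UNIV t"
    and sep: "\<And>n y y' h h' c c'. (\<And>m. m \<le> n \<Longrightarrow> h \<in> W m y) \<Longrightarrow> (\<And>m. m \<le> n \<Longrightarrow> h' \<in> W m y') \<Longrightarrow>
        h - h' = c - c' \<Longrightarrow> c \<in> {0} \<Longrightarrow> c' \<in> {0} \<Longrightarrow> y n = y' n"
    and J0: "\<And>n k. 0 \<in> J n k"
    and JW: "\<And>n y g. g \<in> J n (y n) \<Longrightarrow> g + t y \<in> W n y"
  have tW: "t y \<in> W n y" for n y
    using JW[OF J0] by simp
  have t_inj: "y = y'" if "t y = t y'" for y y'
  proof
    fix n
    show "y n = y' n"
    proof (rule sep[where y = y and y' = y' and n = n])
      show "t y - t y' = 0 - 0"
        using that by simp
    qed (simp_all add: tW)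
  qed
  \<comment> \<open>The minimum keeps \<open>D w\<close> in the compact product for every real
    \<open>w\<close>; on the unit interval it changes nothing.\<close>
  define D where "D w = (\<lambda>n. min (nat \<lfloor>2 ^ n * w\<rfloor>) (2 ^ n))" for w :: real
  have D [measurable]: "D \<in> borel_measurable borel"
  proof (rule measurable_coordinatewise_then_product)
    fix n
    have fl: "(\<lambda>w :: real. \<lfloor>2 ^ n * w\<rfloor>) \<in> borel \<rightarrow>\<^sub>M count_space UNIV"
      by measurable
    show "(\<lambda>w. D w n) \<in> borel_measurable borel"
      unfolding D_def by (rule measurable_compose[OF fl]) simp
  qed
  have D_inj: "w = w'" if w: "w \<in> {0<..<1}" "w' \<in> {0<..<1}" and eq: "D w = D w'" for w w'
  proof (rule ccontr)
    assume "w \<noteq> w'"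
    then obtain n where n: "(1 / 2) ^ n < \<bar>w - w'\<bar>"
      using real_arch_pow_inv[of "\<bar>w - w'\<bar>" "1 / 2"] by auto
    have fl: "D v n = nat \<lfloor>2 ^ n * v\<rfloor>" if "v \<in> {0<..<1}" for v
    proof -
      have "\<lfloor>2 ^ n * v\<rfloor> \<le> 2 ^ n"
        using that by (simp add: floor_le_iff) (smt (verit) mult_less_cancel_left2 zero_less_power)
      then show ?thesis
        by (simp add: D_def nat_le_iff)
    qed
    have "nat \<lfloor>2 ^ n * w\<rfloor> = nat \<lfloor>2 ^ n * w'\<rfloor>"
      using fl[OF w(1)] fl[OF w(2)] eq by simp
    then have "\<lfloor>2 ^ n * w\<rfloor> = \<lfloor>2 ^ n * w'\<rfloor>"
      using w by (subst (asm) eq_nat_nat_iff) auto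
    then have "\<bar>2 ^ n * w - 2 ^ n * w'\<bar> < 1"
      by linarith
    then have "2 ^ n * \<bar>w - w'\<bar> < 1"
      by (simp add: abs_mult flip: right_diff_distrib)
    then show False
      using n by (simp add: field_simps power_divide)
  qed
  have tD [measurable]: "(\<lambda>w. t (D w)) \<in> borel_measurable borel"
    by (rule measurable_compose[OF D borel_measurable_continuous_onI[OF t]])
  define C where "C = t ` {y. \<forall>n. y n \<le> 2 ^ n}"
  define \<nu> where "\<nu> = distr unit_measure borel (\<lambda>w. t (D w))"
  interpret U: prob_space unit_measure
    by (rule prob_space_unit_measure)
  have em: "emeasure \<nu> A = emeasure unit_measure {w. t (D w) \<in> A}" if "A \<in> sets borel" for A
    unfolding \<nu>_def using that by (subst emeasure_distr) (auto simp: vimage_def sets_eq_imp_space_eq[OF sets_unit_measure])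
  have C: "compact C"
    unfolding C_def by (intro compact_continuous_image compact_prod_atMost continuous_on_subset[OF t]) auto
  show ?thesis
  proof (rule that[of C \<nu>])
    show "C \<noteq> {}"
      unfolding C_def by (auto intro: exI[of _ "\<lambda>_. 0"])
    show "prob_space \<nu>"
      unfolding \<nu>_def by (rule U.prob_space_distr) measurable
    have "{w. t (D w) \<in> - C} = {}"
      by (auto simp: C_def D_def)
    then show "emeasure \<nu> (- C) = 0"
      using C by (subst em) (auto simp: compact_imp_closed borel_comp)
    show "emeasure \<nu> {x} = 0" for x
    proof -
      have meas: "{w. t (D w) \<in> {x}} \<in> sets borel"
        using measurable_sets[OF tD, of "{x}"] by (simp add: vimage_def)
      have "\<exists>w0. {w. t (D w) \<in> {x}} \<inter> {0<..<1} \<subseteq> {w0}"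
        using t_inj D_inj by blast
      then obtain w0 where "{w. t (D w) \<in> {x}} \<inter> {0<..<1} \<subseteq> {w0}"
        by blast
      then have "emeasure lborel ({w. t (D w) \<in> {x}} \<inter> {0<..<1}) \<le> emeasure lborel {w0}"
        by (intro emeasure_mono) auto
      then show ?thesis
        using meas by (simp add: em emeasure_unit_measure)
    qed
  qed (use C in \<open>auto simp: \<nu>_def\<close>)
qed simp

theorem theorem1p4:
  fixes \<xi> :: omega1
  assumes "\<not> locally_compact_space (euclidean :: 'a::{topological_ab_group_add, polish_space} topology)"
    and "1 \<le> \<xi>"
  shows "\<exists>B :: 'a set. B \<in> sets borel \<and> haar_null B \<and>
    \<not> (\<exists>H. H \<in> Pi0 \<xi> \<and> haar_null H \<and> B \<subseteq> H)"
proof -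

  \<comment> \<open>The atomless measure, the coding of laws and the universal set\<close>
  obtain C :: "'a set" and \<nu> :: "'a measure" where
    C: "compact C" "C \<noteq> {}" and \<nu>: "prob_space \<nu>" "sets \<nu> = sets borel"
    "emeasure \<nu> (- C) = 0" "\<And>x. emeasure \<nu> {x} = 0"
    using ex_atomless_measure_on_compact[OF assms(1)] by metis
  obtain \<phi> :: "(nat \<Rightarrow> nat) \<Rightarrow> real \<Rightarrow> 'a" where
    \<phi> [measurable]: "(\<lambda>p. \<phi> (fst p) (snd p)) \<in> borel_measurable (borel \<Otimes>\<^sub>M borel)"
    and \<phi>_law: "\<And>\<mu>. prob_space \<mu> \<Longrightarrow> sets \<mu> = sets borel \<Longrightarrow> \<exists>q. distr unit_measure borel (\<phi> q) = \<mu>"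
    using universal_random_variable by metis
  \<comment> \<open>Universality for the product of the Baire space with the group lets a code serve
    as the parameter of its own set.\<close>
  obtain U :: "((nat \<Rightarrow> nat) \<times> (nat \<Rightarrow> nat) \<times> 'a) set" where
    U: "U \<in> sets borel" "\<And>S. in_Sigma0 \<xi> S \<Longrightarrow> \<exists>c. S = {p. (c, p) \<in> U}"
    using borel_universal_Sigma0[of \<xi>] by metis
  show ?thesis
  proof (rule separating_translations[OF assms(1) C(1)])
    fix t :: "(nat \<Rightarrow> nat) \<Rightarrow> 'a" and W and J :: "nat \<Rightarrow> nat \<Rightarrow> 'a set"
    assume t: "continuous_on UNIV t" and W: "\<And>n y. open (W n y)"
      and W_cong: "\<And>n y y'. (\<And>i. i \<le> n \<Longrightarrow> y i = y' i) \<Longrightarrow> W n y = W n y'"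
      and sep: "\<And>n y y' h h' c c'. (\<And>m. m \<le> n \<Longrightarrow> h \<in> W m y) \<Longrightarrow> (\<And>m. m \<le> n \<Longrightarrow> h' \<in> W m y') \<Longrightarrow>
        h - h' = c - c' \<Longrightarrow> c \<in> C \<Longrightarrow> c' \<in> C \<Longrightarrow> y n = y' n"
      and J: "\<And>n k. open (J n k)" and J_mono: "\<And>n k k'. k \<le> k' \<Longrightarrow> J n k \<subseteq> J n k'"
      and J_cover: "\<And>K. compact K \<Longrightarrow> \<exists>r. \<forall>n. K \<subseteq> J n (r n)"
      and JW: "\<And>n y g. g \<in> J n (y n) \<Longrightarrow> g + t y \<in> W n y"
    have t_meas [measurable]: "t \<in> borel_measurable borel"
      by (rule borel_measurable_continuous_onI[OF t])

    \<comment> \<open>Decoding of triples and Borel choice of a point in a section\<close>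
    define dq dx where "dq y = (\<lambda>n. fst (prod_decode (fst (prod_decode (y n)))))"
      and "dx y = (\<lambda>n. snd (prod_decode (fst (prod_decode (y n)))))" for y :: "nat \<Rightarrow> nat"
    define f where "f y w = \<phi> (dq y) w" for y w
    have cont: "continuous_on UNIV (\<lambda>y. F (y n))" for F :: "nat \<Rightarrow> nat" and n :: nat
      by (rule continuous_on_compose2[of UNIV F UNIV "\<lambda>y. y n"]) auto
    have coord: "(\<lambda>y. F (y n)) \<in> borel_measurable borel" for F :: "nat \<Rightarrow> nat" and n :: nat
      by (rule borel_measurable_continuous_onI[OF cont])
    have [measurable]: "dq \<in> borel_measurable borel" "dx \<in> borel_measurable borel"
      unfolding dq_def dx_def by (rule measurable_coordinatewise_then_product, rule coord)+
    have f_meas [measurable]: "(\<lambda>p. f (fst p) (snd p)) \<in> borel_measurable (borel \<Otimes>\<^sub>M borel)"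
      unfolding f_def using measurable_compose[OF _ \<phi>, of "\<lambda>p. (dq (fst p), snd p)"] by simp
    \<comment> \<open>Here \<open>dx y\<close> is both code and parameter. As \<open>U\<close> codes
      the \<open>Sigma0\<close> sets, the last condition says that \<open>f y w\<close> avoids the
      \<open>Pi0\<close> section coded by \<open>dx y\<close>. The third component of the triple is
      not decoded; it acts only by making \<open>y n\<close> large in
      \<open>J n (y n)\<close>.\<close>
    define P where "P = {(y, w). 0 < w \<and> w < 1 \<and> (\<forall>n. f y w \<in> J n (y n)) \<and> (dx y, dx y, f y w) \<in> U}"
    have P: "P \<in> sets (borel \<Otimes>\<^sub>M borel)"
    proof -
      have 1: "UNIV \<times> {0<..<1} \<in> sets ((borel :: (nat \<Rightarrow> nat) measure) \<Otimes>\<^sub>M (borel :: real measure))"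
        by auto
      have 2: "({y :: nat \<Rightarrow> nat. y n = k} \<times> UNIV) \<inter> (\<lambda>p. f (fst p) (snd p)) -` J n k \<in> sets (borel \<Otimes>\<^sub>M borel)" for n k
      proof (intro sets.Int pair_measureI borel_open open_coordinate_eq open_UNIV)
        show "(\<lambda>p. f (fst p) (snd p)) -` J n k \<in> sets (borel \<Otimes>\<^sub>M borel)"
          using measurable_sets[OF f_meas borel_open[OF J[of n k]]] by (simp add: space_pair_measure)
      qed
      have "(\<lambda>p. (dx (fst p), dx (fst p), f (fst p) (snd p))) \<in> borel_measurable (borel \<Otimes>\<^sub>M borel)"
        by measurable
      from measurable_sets[OF this U(1)]
      have 3: "(\<lambda>p. (dx (fst p), dx (fst p), f (fst p) (snd p))) -` U \<in> sets (borel \<Otimes>\<^sub>M borel)"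
        by (simp add: space_pair_measure)
      have "P = (UNIV \<times> {0<..<1}) \<inter>
          (\<Inter>n. \<Union>k. ({y. y n = k} \<times> UNIV) \<inter> (\<lambda>p. f (fst p) (snd p)) -` J n k) \<inter>
          (\<lambda>p. (dx (fst p), dx (fst p), f (fst p) (snd p))) -` U"
        by (auto simp: P_def)
      also have "\<dots> \<in> sets (borel \<Otimes>\<^sub>M borel)"
        using 1 2 3 by (intro sets.Int sets.countable_INT sets.countable_UN) auto
      finally show ?thesis .
    qed
    interpret unit: prob_space unit_measure
      by (rule prob_space_unit_measure)
    \<comment> \<open>The choice is made in the unit interval, where the order of the reals is
      available; \<open>f y\<close> then carries the chosen number to the group.\<close>
    have "\<exists>z\<in>borel_measurable borel. \<forall>y\<in>space borel. 0 < measure unit_measure (Pair y -` P) \<longrightarrow> (y, z y) \<in> P"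
      by (rule borel_uniformization_positive_measure[OF unit.finite_measure_axioms sets_unit_measure P])
         (auto simp: P_def)
    then obtain z where z [measurable]: "z \<in> borel_measurable borel"
      and zP: "\<And>y. 0 < measure unit_measure (Pair y -` P) \<Longrightarrow> (y, z y) \<in> P"
      by auto
    define pos where "pos y \<longleftrightarrow> 0 < measure unit_measure (Pair y -` P)" for y
    define s where "s y = f y (z y) + t y" for y
    have s_meas [measurable]: "s \<in> borel_measurable borel"
    proof -
      have "(\<lambda>y. f y (z y)) \<in> borel_measurable borel"
        using measurable_compose[OF _ f_meas, of "\<lambda>y. (y, z y)" borel] by simp
      then show ?thesis
        unfolding s_def by measurable
    qed
    have pos_meas [measurable]: "Measurable.pred borel pos"
      unfolding pos_def
      using measurable_measure_section[OF unit.finite_measure_axioms sets_unit_measure P] by measurable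

    \<comment> \<open>The set \<open>E\<close> and its Borel measurability by decoding\<close>
    define E where "E = {h. \<exists>y. (\<forall>n. h \<in> W n y) \<and> pos y \<and> h = s y}"
    obtain c0 where c0: "c0 \<in> C"
      using C(2) by blast
    have uniq: "y n = y' n" if "\<And>m. m \<le> n \<Longrightarrow> h \<in> W m y" "\<And>m. m \<le> n \<Longrightarrow> h \<in> W m y'" for h n y y'
      using sep[of n h y h y' c0 c0] that c0 by simp
    have E_borel: "E \<in> sets borel"
    proof -
      \<comment> \<open>\<open>A n k\<close> collects the points that admit a code up to
        \<open>n\<close> with entry \<open>k\<close> at \<open>n\<close>. It is open, and by
        \<open>uniq\<close> each point admits at most one \<open>k\<close>, so \<open>Y\<close> is a
        Borel decoding map.\<close>
      define A where "A n k = {h. \<exists>y. y n = k \<and> (\<forall>m\<le>n. h \<in> W m y)}" for n k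
      have A_open: "open (A n k)" for n k
      proof -
        have "A n k = (\<Union>y\<in>{y. y n = k}. \<Inter>m\<in>{..n}. W m y)"
          by (auto simp: A_def)
        then show ?thesis
          using W by (auto intro!: open_INT)
      qed
      have A_borel [measurable]: "A n k \<in> sets borel" for n k
        by (rule borel_open[OF A_open])
      define Y where "Y h = (\<lambda>n. LEAST k. h \<in> A n k)" for h
      have [measurable]: "Y \<in> borel_measurable borel"
      proof (rule measurable_coordinatewise_then_product)
        fix n
        have "(\<lambda>h. LEAST k. h \<in> A n k) \<in> borel \<rightarrow>\<^sub>M count_space UNIV"
          by measurable
        then show "(\<lambda>h. Y h n) \<in> borel_measurable borel"
          unfolding Y_def by (rule measurable_compose[of _ _ _ "\<lambda>k. k"]) simp
      qed
      have Y_eq: "Y h n = y n" if "\<And>m. m \<le> n \<Longrightarrow> h \<in> W m y" for h n y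
      proof -
        have "h \<in> A n k \<longleftrightarrow> k = y n" for k
          unfolding A_def using that uniq by blast
        then show ?thesis
          by (auto simp: Y_def intro: Least_equality)
      qed
      \<comment> \<open>The code \<open>y\<close> witnessing level \<open>n\<close> may vary with
        \<open>n\<close>, but \<open>Y h\<close> agrees with it up to \<open>n\<close>, and
        \<open>W n\<close> depends on these entries only.\<close>
      have YW: "h \<in> W n (Y h)" if h: "h \<in> (\<Inter>n. \<Union>k. A n k)" for h n
      proof -
        obtain y where y: "\<And>m. m \<le> n \<Longrightarrow> h \<in> W m y"
          using h by (auto simp: A_def)
        have "W n (Y h) = W n y"
          by (rule W_cong, rule Y_eq) (use y in auto)
        then show ?thesis
          using y by simp
      qed
      have "E = (\<Inter>n. \<Union>k. A n k) \<inter> {h. pos (Y h) \<and> dist h (s (Y h)) = 0}"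
      proof (intro set_eqI iffI)
        fix h assume "h \<in> E"
        then obtain y where y: "\<And>n. h \<in> W n y" "pos y" "h = s y"
          by (auto simp: E_def)
        then have "Y h = y"
          using Y_eq by blast
        moreover have "h \<in> (\<Inter>n. \<Union>k. A n k)"
          using y(1) by (auto simp: A_def)
        ultimately show "h \<in> (\<Inter>n. \<Union>k. A n k) \<inter> {h. pos (Y h) \<and> dist h (s (Y h)) = 0}"
          using y by simp
      qed (use YW in \<open>auto simp: E_def\<close>)
      moreover have "{h. pos (Y h) \<and> dist h (s (Y h)) = 0} \<in> sets borel"
      proof -
        have "Measurable.pred borel (\<lambda>h. pos (Y h) \<and> dist h (s (Y h)) = 0)"
          by measurable
        then show ?thesis
          by (simp add: pred_def)
      qed
      ultimately show ?thesis
        by auto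
    qed

    \<comment> \<open>Nullity of all translates of \<open>E\<close> for the atomless measure\<close>
    have "haar_null E"
      unfolding haar_null_def
    proof (intro bexI[of _ E] exI[of _ \<nu>] conjI allI)
      fix g
      have "(\<lambda>x. x + g) ` E = (\<lambda>x. x - g) -` E"
        by force
      moreover have "(\<lambda>x. x - g) -` E \<in> sets borel"
        by (intro measurable_sets_borel[OF borel_measurable_continuous_onI] E_borel continuous_intros)
      ultimately have Eg: "(\<lambda>x. x + g) ` E \<in> sets borel"
        by simp
      have "\<exists>p. (\<lambda>x. x + g) ` E \<inter> C \<subseteq> {p}"
      proof -
        \<comment> \<open>The difference of two points of \<open>E\<close> translated into
          \<open>C\<close> is a difference of points of \<open>C\<close>, so both points have the
          same code, and the code determines the point of \<open>E\<close>.\<close>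
        have "h = h'" if "h \<in> E" "h' \<in> E" "h + g \<in> C" "h' + g \<in> C" for h h'
        proof -
          obtain y y' where y: "\<And>n. h \<in> W n y" "h = s y" "\<And>n. h' \<in> W n y'" "h' = s y'"
            using \<open>h \<in> E\<close> \<open>h' \<in> E\<close> by (auto simp: E_def)
          have "y n = y' n" for n
            by (rule sep[of n h y h' y' "h + g" "h' + g"]) (use that y in auto)
          then show ?thesis
            using y by (metis ext)
        qed
        then show ?thesis
          by blast
      qed
      then obtain p where "(\<lambda>x. x + g) ` E \<inter> C \<subseteq> {p}"
        by blast
      then have "emeasure \<nu> ((\<lambda>x. x + g) ` E) \<le> emeasure \<nu> ({p} \<union> - C)"
        using C(1) by (intro emeasure_mono) (auto simp: \<nu>(2) compact_imp_closed borel_comp)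
      also have "\<dots> \<le> emeasure \<nu> {p} + emeasure \<nu> (- C)"
        using C(1) by (intro emeasure_subadditive) (auto simp: \<nu>(2) compact_imp_closed borel_comp)
      finally show "emeasure \<nu> ((\<lambda>x. x + g) ` E) = 0"
        using \<nu> by simp
    qed (use \<nu> E_borel in auto)

    \<comment> \<open>Diagonalization against the Haar null sets in \<open>Pi0 \<xi>\<close>\<close>
    moreover have "\<not> (\<exists>H. H \<in> Pi0 \<xi> \<and> haar_null H \<and> E \<subseteq> H)"
    proof
      assume "\<exists>H. H \<in> Pi0 \<xi> \<and> haar_null H \<and> E \<subseteq> H"
      then obtain H where H: "H \<in> Pi0 \<xi>" "haar_null H" "E \<subseteq> H"
        by blast
      have H_borel: "H \<in> sets borel"
        by (rule Pi0_borel[OF H(1)])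
      obtain B \<mu> where B: "B \<in> sets borel" "H \<subseteq> B" and \<mu>: "prob_space \<mu>" "sets \<mu> = sets borel"
        "\<And>g. emeasure \<mu> ((\<lambda>x. x + g) ` B) = 0"
        using H(2) unfolding haar_null_def by blast
      interpret \<mu>: prob_space \<mu> by fact
      have space_\<mu>: "space \<mu> = UNIV"
        using sets_eq_imp_space_eq[OF \<mu>(2)] by simp
      obtain K where K: "compact K" "0 < emeasure \<mu> K"
      proof -
        have "0 < emeasure \<mu> UNIV"
          using \<mu>.emeasure_space_1 space_\<mu> by simp
        also have "emeasure \<mu> UNIV = (SUP K\<in>{K. K \<subseteq> UNIV \<and> compact K}. emeasure \<mu> K)"
          by (rule inner_regular[OF \<mu>(2)]) (auto simp: \<mu>.emeasure_space_1)
        finally show ?thesis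
          using that by (auto simp: less_SUP_iff)
      qed
      obtain r where r: "\<And>n. K \<subseteq> J n (r n)"
        using J_cover[OF K(1)] by blast
      obtain q where q: "distr unit_measure borel (\<phi> q) = \<mu>"
        using \<phi>_law[OF \<mu>(1,2)] by blast
      \<comment> \<open>The components \<open>q\<close> and \<open>r\<close> are fixed by \<mu> and
        \<open>K\<close>. The middle one stays free, to be filled by the code of a set whose
        definition uses \<open>y\<close> itself.\<close>
      define y where "y x = (\<lambda>n. prod_encode (prod_encode (q n, x n), r n))" for x
      have dec: "dq (y x) = q" "dx (y x) = x" for x
        by (simp_all add: dq_def dx_def y_def)
      have y_cont: "continuous_on UNIV y"
        unfolding y_def
        by (rule continuous_on_coordinatewise_then_product) (rule cont)
      define S where "S = (\<lambda>p. snd p + t (y (fst p))) -` H"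
      have "S \<in> Pi0 \<xi>"
        unfolding S_def
        by (intro Pi0_vimage[OF H(1)] continuous_intros continuous_on_compose2[OF t] continuous_on_compose2[OF y_cont]) auto
      then obtain c where c: "- S = {p. (c, p) \<in> U}"
        using U(2) by (auto simp: Pi0_def Sigma0_def)
      \<comment> \<open>The section of \<open>S\<close> at the parameter \<open>c\<close> is the
        translate of \<open>H\<close> by \<open>- t y0\<close>, and \<open>c\<close> is also the
        code of the complement of \<open>S\<close>.\<close>
      define y0 where "y0 = y c"
      have \<phi>q [measurable]: "\<phi> q \<in> borel_measurable borel"
        using measurable_compose[OF measurable_Pair1' \<phi>, of q] by simp
      have "pos y0"
      proof -
        define Ht where "Ht = (\<lambda>g. g + t y0) -` H"
        have Ht: "Ht \<in> sets borel"
          unfolding Ht_def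
          by (intro measurable_sets_borel[OF borel_measurable_continuous_onI] H_borel continuous_intros)
        have "Ht \<subseteq> (\<lambda>x. x + (- t y0)) ` B"
        proof
          fix g assume "g \<in> Ht"
          then show "g \<in> (\<lambda>x. x + (- t y0)) ` B"
            using B(2) by (intro image_eqI[of _ _ "g + t y0"]) (auto simp: Ht_def)
        qed
        moreover have "(\<lambda>x. x + (- t y0)) ` B \<in> sets borel"
        proof -
          have "(\<lambda>x. x + (- t y0)) ` B = (\<lambda>x. x + t y0) -` B"
            by force
          moreover have "(\<lambda>x. x + t y0) -` B \<in> sets borel"
            by (intro measurable_sets_borel[OF borel_measurable_continuous_onI] B continuous_intros)
          ultimately show ?thesis
            by simp
        qed
        ultimately have "emeasure \<mu> Ht \<le> emeasure \<mu> ((\<lambda>x. x + (- t y0)) ` B)"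
          using \<mu>(2) by (intro emeasure_mono) auto
        then have Ht0: "Ht \<in> null_sets \<mu>"
          unfolding \<mu>(3) using \<mu>(2) Ht by (auto simp: null_sets_def)
        have K_borel: "K \<in> sets borel"
          using K(1) by (simp add: compact_imp_closed)
        \<comment> \<open>The translate \<open>Ht\<close> is null for \<mu>, so
          \<open>K - Ht\<close> keeps the measure of \<open>K\<close>. As \<mu> is the law of
          \<open>\<phi> q\<close>, its preimage has positive uniform measure, and inside the unit
          interval it lies in the section of \<open>P\<close> at \<open>y0\<close>.\<close>
        have "0 < emeasure \<mu> (K - Ht)"
          using K(2) Ht0 K_borel by (simp add: emeasure_Diff_null_set \<mu>(2))
        also have "emeasure \<mu> (K - Ht) = emeasure unit_measure (\<phi> q -` (K - Ht))"
          using K_borel Ht unfolding q[symmetric]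
          by (subst emeasure_distr) (auto simp: sets_eq_imp_space_eq[OF sets_unit_measure])
        also have "\<dots> = emeasure unit_measure (\<phi> q -` (K - Ht) \<inter> {0<..<1})"
          using measurable_sets_borel[OF \<phi>q, of "K - Ht"] K_borel Ht
          by (simp add: emeasure_unit_measure Int_assoc)
        also have "\<dots> \<le> emeasure unit_measure (Pair y0 -` P)"
        proof (rule emeasure_mono)
          show "\<phi> q -` (K - Ht) \<inter> {0<..<1} \<subseteq> Pair y0 -` P"
          proof
            fix w assume w: "w \<in> \<phi> q -` (K - Ht) \<inter> {0<..<1}"
            have fw: "f y0 w = \<phi> q w"
              by (simp add: f_def y0_def dec)
            have "f y0 w \<in> J n (y0 n)" for n
            proof -
              have "r n \<le> y0 n"
                by (simp add: y0_def y_def le_prod_encode_2)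
              then show ?thesis
                using w r[of n] J_mono[of "r n" "y0 n" n] fw by auto
            qed
            moreover have "(c, f y0 w) \<in> - S"
              using w fw by (simp add: S_def Ht_def y0_def)
            then have "(dx y0, dx y0, f y0 w) \<in> U"
              unfolding c by (simp add: y0_def dec)
            ultimately show "w \<in> Pair y0 -` P"
              using w by (simp add: P_def)
          qed
          show "Pair y0 -` P \<in> sets unit_measure"
            using sets_Pair1[OF P] by simp
        qed
        finally show ?thesis
          unfolding pos_def by (simp add: unit.emeasure_eq_measure)
      qed
      then have zy: "(y0, z y0) \<in> P"
        unfolding pos_def by (rule zP)
      have "s y0 \<in> E"
      proof -
        have "s y0 \<in> W n y0" for n
          unfolding s_def by (rule JW) (use zy in \<open>simp add: P_def\<close>)
        then show ?thesis
          using \<open>pos y0\<close> by (auto simp: E_def)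
      qed
      then have "s y0 \<in> H"
        using H(3) by blast
      moreover have "(c, f y0 (z y0)) \<in> - S"
        unfolding c using zy by (simp add: P_def y0_def dec)
      then have "s y0 \<notin> H"
        by (simp add: S_def s_def y0_def)
      ultimately show False
        by blast
    qed
    ultimately show ?thesis
      using E_borel by blast
  qed
qed

end
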